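(* Let $\alpha\in(2,4)$. For all sufficiently large $\lambda$, there exists initial data $u^0\in\bigcap_{s<\alpha-2}H^s$ that gives rise to two distinct Leray--Hopf solutions of the dyadic (Obukhov) system $$\partial_t u_k+N_k^2u_k-N_{k-1}^\alpha u_{k-1}u_k+N_k^\alpha u_{k+1}^2=0,\qquad u_k(0)=u_k^0,\qquad k\in\mathbb N,$$ i.e. there are two distinct functions $u,v:[0,\infty)\to\mathbb R^{\mathbb N}$, both solving this system with the same initial data $u^0$, and both Leray--Hopf.
   Context: $\mathbb N=\{0,1,2,\dots\}$. $N_k=\lambda^kN_0$, where $\lambda>1$ and $N_0>0$ is a fixed base frequency. The system is closed by the convention $u_{-1}=0$. The viscosity has been normalized to $1$. "Sufficiently large $\lambda$" means $\lambda\ge\lambda_0(\alpha)$ for some $\lambda_0(\alpha)$ depending only on $\alpha$. A solution on a time interval is a family of continuous functions $u_k$ satisfying each scalar ODE (with the prescribed initial values). For real sequences $a=(a_k)_{k\in\mathbb N}$, $\|a\|_{H^s}=\big(\sum_{k}\lambda^{2sk}|a_k|^2\big)^{1/2}$, $H^s$ is the space of sequences with finite $H^s$ norm, and $L^2:=H^0$. Leray--Hopf: for initial data $u^0\in L^2$, a solution $u(t)$ of the system on $[0,T]$ is Leray--Hopf if it belongs to $L^\infty_tL^2\cap L^2_tH^1$ (on $[0,T]$) and obeys the energy inequality $$\sum_{k\in\mathbb N}\frac{u_k^2(t)}2+\int_0^t\sum_{k\in\mathbb N}N_k^2u_k^2(s)\,ds\le\sum_{k\in\mathbb N}\frac{(u_k^0)^2}2$$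 for all $t\in[0,T]$. A solution on $[0,\infty)$ is Leray--Hopf if it is so on $[0,T]$ for every $T>0$. *)

theory Defs
  imports "HOL-Analysis.Analysis"
begin

definition freq :: "real \<Rightarrow> real \<Rightarrow> nat \<Rightarrow> real" where
  "freq lam N0 k = lam ^ k * N0"

definition Hs_norm :: "real \<Rightarrow> real \<Rightarrow> (nat \<Rightarrow> real) \<Rightarrow> real" where
  "Hs_norm lam s a = sqrt (\<Sum>k. lam powr (2 * s * real k) * \<bar>a k\<bar>\<^sup>2)"

definition Hs :: "real \<Rightarrow> real \<Rightarrow> (nat \<Rightarrow> real) set" where
  "Hs lam s = {a. summable (\<lambda>k. lam powr (2 * s * real k) * \<bar>a k\<bar>\<^sup>2)}"

abbreviation L2 :: "real \<Rightarrow> (nat \<Rightarrow> real) set" where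
  "L2 lam \<equiv> Hs lam 0"

text \<open>A trajectory is a map \<open>u :: real \<Rightarrow> nat \<Rightarrow> real\<close>, where \<open>u t k\<close> is the \<open>k\<close>-th component at
  time \<open>t\<close>; only its values on the time interval under consideration matter.
  The right-hand side below is that of the equation solved for the time derivative; the case
  \<open>k = 0\<close> of the incoming transfer term encodes the convention that the component of index
  \<open>-1\<close> vanishes.\<close>

definition obukhov_rhs :: "real \<Rightarrow> real \<Rightarrow> real \<Rightarrow> (nat \<Rightarrow> real) \<Rightarrow> nat \<Rightarrow> real" where
  "obukhov_rhs \<alpha> lam N0 a k =
     - (freq lam N0 k)\<^sup>2 * a k
     + (case k of 0 \<Rightarrow> 0 | Suc j \<Rightarrow> freq lam N0 j powr \<alpha> * a j * a k)
     - freq lam N0 k powr \<alpha> * (a (Suc k))\<^sup>2"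

text \<open>The derivative is taken within the time interval, hence one-sided at its end points.\<close>

definition obukhov_solution ::
  "real \<Rightarrow> real \<Rightarrow> real \<Rightarrow> real set \<Rightarrow> (nat \<Rightarrow> real) \<Rightarrow> (real \<Rightarrow> nat \<Rightarrow> real) \<Rightarrow> bool" where
  "obukhov_solution \<alpha> lam N0 I u0 u \<longleftrightarrow>
     (\<forall>k. continuous_on I (\<lambda>t. u t k)) \<and>
     (\<forall>k. \<forall>t\<in>I. ((\<lambda>r. u r k) has_real_derivative obukhov_rhs \<alpha> lam N0 (u t) k) (at t within I)) \<and>
     (\<forall>k. u 0 k = u0 k)"

text \<open>In the next two definitions only the norm conditions are imposed: for a trajectory with
  continuous components, measurability in the sequence spaces is automatic.\<close>

definition Linfty_L2 :: "real \<Rightarrow> real \<Rightarrow> (real \<Rightarrow> nat \<Rightarrow> real) set" where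
  "Linfty_L2 lam T =
     {u. \<exists>C. AE t in lebesgue_on {0..T}. u t \<in> L2 lam \<and> Hs_norm lam 0 (u t) \<le> C}"

definition L2_H1 :: "real \<Rightarrow> real \<Rightarrow> (real \<Rightarrow> nat \<Rightarrow> real) set" where
  "L2_H1 lam T =
     {u. (AE t in lebesgue_on {0..T}. u t \<in> Hs lam 1) \<and>
         integrable (lebesgue_on {0..T}) (\<lambda>t. (Hs_norm lam 1 (u t))\<^sup>2)}"

text \<open>Sums and time integral of nonnegative quantities are taken in \<open>[0, \<infinity>]\<close>, so that a divergent
  left-hand side violates the inequality.\<close>

definition energy_inequality ::
  "real \<Rightarrow> real \<Rightarrow> (nat \<Rightarrow> real) \<Rightarrow> (real \<Rightarrow> nat \<Rightarrow> real) \<Rightarrow> real \<Rightarrow> bool" where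
  "energy_inequality lam N0 u0 u t \<longleftrightarrow>
     (\<Sum>k. ennreal ((u t k)\<^sup>2 / 2))
       + (\<integral>\<^sup>+ s\<in>{0..t}. (\<Sum>k. ennreal ((freq lam N0 k)\<^sup>2 * (u s k)\<^sup>2)) \<partial>lborel)
     \<le> (\<Sum>k. ennreal ((u0 k)\<^sup>2 / 2))"

definition leray_hopf_on ::
  "real \<Rightarrow> real \<Rightarrow> real \<Rightarrow> real \<Rightarrow> (nat \<Rightarrow> real) \<Rightarrow> (real \<Rightarrow> nat \<Rightarrow> real) \<Rightarrow> bool" where
  "leray_hopf_on \<alpha> lam N0 T u0 u \<longleftrightarrow>
     u0 \<in> L2 lam \<and>
     obukhov_solution \<alpha> lam N0 {0..T} u0 u \<and>
     u \<in> Linfty_L2 lam T \<inter> L2_H1 lam T \<and>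
     (\<forall>t\<in>{0..T}. energy_inequality lam N0 u0 u t)"

definition leray_hopf ::
  "real \<Rightarrow> real \<Rightarrow> real \<Rightarrow> (nat \<Rightarrow> real) \<Rightarrow> (real \<Rightarrow> nat \<Rightarrow> real) \<Rightarrow> bool" where
  "leray_hopf \<alpha> lam N0 u0 u \<longleftrightarrow>
     obukhov_solution \<alpha> lam N0 {0..} u0 u \<and>
     (\<forall>T>0. leray_hopf_on \<alpha> lam N0 T u0 u)"

end

(*
  Put X_k = N_k^alpha u_k / N_(k+1)^2, nu = lam^2 and eps = lam^(2 - alpha), and let time be measured in
  units of N_0^(-2). The system becomes
    X_k' = nu^k ((X_(k-1) - 1) X_k - nu eps^2 X_(k+1)^2),
  and the pair (x, y) = (X_(k-1), eps X_k) in the time variable nu^k t is a small perturbation of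
    x' = -y^2,  y' = (x - 1) y,
  for which (x - 1)^2 + y^2 is conserved. Starting near (2, 0) the mode X_k absorbs the energy of X_(k-1)
  and, if x starts at exactly the right place, both decay: X_(k-1) is killed. This pattern can be imposed
  with all odd modes killed, or with all even modes killed. Each choice requires the initial values of the
  killed modes to be tuned, so the two solutions together use up exactly the freedom in one set of
  initial data. The tuning is done for truncated systems by a multidimensional intermediate value argument
  (Kuhn's combinatorial lemma), applied to an auxiliary system in which the modes are clipped to the range
  they should have; a trajectory that leaves that range does not come back. The truncation is
  removed by compactness. The condition alpha < 4 makes the growth of a killed mode, driven by the active mode
  below it at relative rate eps^(-1), slower than the decay of its forcing at relative rate nu.
*)
theory Submission
  imports Defs "HOL-Library.Diagonal_Subsequence" "HOL-Real_Asymp.Real_Asymp"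
begin

section \<open>A perturbed pair of modes\<close>

text \<open>Why clip: Kuhn's lemma needs, on opposite faces of the data cube, opposite outcomes for
  the mode tuned there, whatever the other initial values are. Without clips a mistuned killed mode
  could spoil the pairs next to it. With clips each pair sees its neighbours only through a priori
  bounds: the mode below is a relative forcing of size at most (1 + 2 / eps) / nu, the mode above a
  drain of total mass at most eps / 10. The fate of a pair then depends on its own start alone. A
  killed mode can leave its range only through 0 or through \<open>env\<close>, and both exits are
  irreversible, so being strictly inside at the final time means that its clip never acted. Killed
  modes that stay nonnegative also give the energy inequality: the flux out of the modes up to m is
  N_m^alpha u_m u_(m+1)^2, which is nonnegative when u_m is, and killed modes are cofinal. The
  system preserves zero tails, so a truncated solution is an exact solution. The limit is needed
  only because the initial data of the two truncations differ beyond the cut.\<close>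

lemma barrier:
  fixes f :: "real \<Rightarrow> real"
  assumes cont: "continuous_on {s..t} f" and st: "s \<le> t" and init: "f s \<le> 0" and k: "0 < \<kappa>"
    and der: "\<And>r. s < r \<Longrightarrow> r < t \<Longrightarrow> 0 < f r \<Longrightarrow> f r < \<kappa> \<Longrightarrow>
               \<exists>D. (f has_real_derivative D) (at r) \<and> D \<le> C * f r"
  shows "f t \<le> 0"
proof (rule ccontr)
  assume "\<not> f t \<le> 0"
  \<comment> \<open>Between the last time \<open>s1\<close> with f \<le> 0 and the first time
    \<open>t1\<close> at level \<open>m\<close>, f lies in the strip where \<open>der\<close>
    applies, and there \<open>exp (- C * r) * f r\<close> cannot increase. Asking for
    \<open>der\<close> only in a strip is what permits bootstrap arguments later.\<close>
  define m where "m = min (f t) (\<kappa>/2)"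
  have m: "0 < m" "m < \<kappa>" "m \<le> f t" using \<open>\<not> f t \<le> 0\<close> k by (auto simp: m_def min_def)
  define A where "A = {r \<in> {s..t}. f r \<ge> m}"
  have "closed A" unfolding A_def
    by (intro continuous_on_closed_Collect_le continuous_intros cont)
  moreover have tA: "t \<in> A" using m st by (auto simp: A_def)
  moreover have bA: "bdd_below A" by (auto simp: A_def bdd_below_def)
  ultimately have t1A: "Inf A \<in> A" by (intro closed_contains_Inf) auto
  define t1 where "t1 = Inf A"
  have t1: "s \<le> t1" "t1 \<le> t" "f t1 \<ge> m" using t1A by (auto simp: A_def t1_def)
  have before: "f r < m" if "s \<le> r" "r < t1" for r
  proof (rule ccontr)
    assume "\<not> f r < m"
    hence "r \<in> A" using that t1 by (auto simp: A_def)
    hence "t1 \<le> r" unfolding t1_def by (intro cInf_lower bA)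
    thus False using that by simp
  qed
  define B where "B = {r \<in> {s..t1}. f r \<le> 0}"
  have cont1: "continuous_on {s..t1} f" using cont t1 by (auto intro: continuous_on_subset)
  have "closed B" unfolding B_def
    by (intro continuous_on_closed_Collect_le continuous_intros cont1)
  moreover have "s \<in> B" using init t1 by (auto simp: B_def)
  moreover have bB: "bdd_above B" by (auto simp: B_def bdd_above_def)
  ultimately have sB: "Sup B \<in> B" by (intro closed_contains_Sup) auto
  define s1 where "s1 = Sup B"
  have s1: "s \<le> s1" "s1 \<le> t1" "f s1 \<le> 0" using sB by (auto simp: B_def s1_def)
  have after: "f r > 0" if "s1 < r" "r \<le> t1" for r
  proof (rule ccontr)
    assume "\<not> f r > 0"
    hence "r \<in> B" using that s1 by (auto simp: B_def)
    hence "r \<le> s1" unfolding s1_def by (intro cSup_upper bB)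
    thus False using that by simp
  qed
  have "s1 < t1" using s1 t1 m by (cases "s1 = t1") auto
  define g where "g = (\<lambda>r. exp (- C * r) * f r)"
  have "g t1 \<le> g s1"
  proof (rule DERIV_nonpos_imp_decreasing_open[of s1 t1])
    show "s1 \<le> t1" using \<open>s1 < t1\<close> by simp
    show "\<exists>y. (g has_real_derivative y) (at r) \<and> y \<le> 0" if r: "s1 < r" "r < t1" for r
    proof -
      obtain D where D: "(f has_real_derivative D) (at r)" "D \<le> C * f r"
        using der[of r] r s1 t1 after[of r] before[of r] m by force
      have "(g has_real_derivative (exp (- C * r) * (D - C * f r))) (at r)"
        unfolding g_def by (auto intro!: derivative_eq_intros D(1) simp: algebra_simps)
      moreover have "exp (- C * r) * (D - C * f r) \<le> 0"
        using D(2) by (simp add: mult_nonneg_nonpos)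
      ultimately show ?thesis by blast
    qed
    show "continuous_on {s1..t1} g" unfolding g_def
      using s1 t1 by (intro continuous_intros continuous_on_subset[OF cont]) auto
  qed
  moreover have "g s1 \<le> 0" using s1 by (simp add: g_def mult_nonneg_nonpos)
  moreover have "g t1 > 0" using t1 m by (simp add: g_def)
  ultimately show False by simp
qed

lemma first_below:
  fixes f :: "real \<Rightarrow> real"
  assumes cont: "continuous_on {s..t} f" and "s \<le> t" "f t \<le> c" "c < f s"
  obtains r where "s < r" "r \<le> t" "f r = c" "\<And>q. s \<le> q \<Longrightarrow> q < r \<Longrightarrow> c < f q"
proof -
  define A where "A = {r \<in> {s..t}. f r \<le> c}"
  have "closed A" unfolding A_def
    by (intro continuous_on_closed_Collect_le continuous_intros cont)
  moreover have tA: "t \<in> A" using assms by (auto simp: A_def)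
  moreover have bA: "bdd_below A" by (auto simp: A_def bdd_below_def)
  ultimately have "Inf A \<in> A" by (intro closed_contains_Inf) auto
  then have i: "s \<le> Inf A" "Inf A \<le> t" "f (Inf A) \<le> c" by (auto simp: A_def)
  have b: "c < f q" if "s \<le> q" "q < Inf A" for q
  proof (rule ccontr)
    assume "\<not> c < f q"
    hence "q \<in> A" using that i by (auto simp: A_def)
    hence "Inf A \<le> q" by (intro cInf_lower bA)
    thus False using that by simp
  qed
  obtain x where "s \<le> x" "x \<le> Inf A" "f x = c"
    using IVT2'[of f "Inf A" c s] i assms continuous_on_subset[OF cont, of "{s..Inf A}"] by force
  then have "x = Inf A" using b[of x] by force
  moreover have "s \<noteq> Inf A" using \<open>f x = c\<close> \<open>x = Inf A\<close> assms by auto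
  ultimately show ?thesis using that[of "Inf A"] i b \<open>f x = c\<close> by auto
qed

text \<open>Size allowed to a killed mode in the time scale of its killer: no restriction in effect
  during the killing phase of length \<open>L\<close>, then decay at rate 1/4. This is slower than
  the rate 2/5 proved for the square of the killer, so what is left of the flux cannot pull a mode
  back below the envelope.\<close>

definition env :: "real \<Rightarrow> real \<Rightarrow> real" where
  "env L \<tau> = 3 * exp (- (max 0 (\<tau> - L)) / 4)"

lemma env_pos [simp]: "0 < env L \<tau>" by (simp add: env_def)
lemma env_nonneg [simp]: "0 \<le> env L \<tau>" by (simp add: env_def)
lemma env_le_3: "env L \<tau> \<le> 3" by (simp add: env_def)
lemma env_before: "\<tau> \<le> L \<Longrightarrow> env L \<tau> = 3" by (simp add: env_def)
lemma env_after: "L \<le> \<tau> \<Longrightarrow> env L \<tau> = 3 * exp (- (\<tau> - L) / 4)" by (simp add: env_def)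
lemma continuous_env [continuous_intros]:
  "continuous_on S f \<Longrightarrow> continuous_on S (\<lambda>t. env L (f t))"
  unfolding env_def by (intro continuous_intros) auto

text \<open>One exponential valid from time 0 on, at the price of the factor
  \<open>exp (L/2)\<close>, which returns in the smallness condition on the drain.\<close>

lemma env_sq_le: "(env L \<tau>)\<^sup>2 \<le> 9 * exp (L/2) * exp (- \<tau> / 2)"
proof -
  have "env L \<tau> \<le> 3 * exp (- (\<tau> - L) / 4)" by (simp add: env_def)
  then have "(env L \<tau>)\<^sup>2 \<le> (3 * exp (- (\<tau> - L) / 4))\<^sup>2" by (intro power_mono) auto
  also have "\<dots> = 9 * exp (L/2) * exp (- \<tau> / 2)"
    by (simp add: power_mult_distrib exp_double[symmetric] exp_add[symmetric] field_simps)
  finally show ?thesis .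
qed

text \<open>\<open>x\<close> is a killed mode X_j, \<open>y\<close> is eps times its killer X_(j+1),
  and \<tau> is nu^(j+1) t. \<open>\<delta>\<close> is the relative forcing by X_(j-1), of either
  sign; \<open>d\<close> is the loss to X_(j+2), a pulse of total mass at most \<open>D\<close>.
  Only the mass is small, the height \<open>D * \<gamma>\<close> need not be. The logarithm in
  \<open>L\<close> is the time in which y grows from size \<epsilon>, the 300 pays for the fall of x
  and the decay of y, and the 8 in \<open>LT\<close> lets \<open>env\<close> drop below the level
  kept by a low start.\<close>

locale block =
  fixes x y \<delta> d :: "real \<Rightarrow> real" and \<eta> \<gamma> D \<epsilon> L T :: real
  assumes contx: "continuous_on {0..T} x" and conty: "continuous_on {0..T} y"
    and derx: "\<And>\<tau>. 0 < \<tau> \<Longrightarrow> \<tau> < T \<Longrightarrow>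
      (x has_real_derivative \<delta> \<tau> * max 0 (min (env L \<tau>) (x \<tau>)) - (max (-2) (min 2 (y \<tau>)))\<^sup>2) (at \<tau>)"
    and dery: "\<And>\<tau>. 0 < \<tau> \<Longrightarrow> \<tau> < T \<Longrightarrow>
      (y has_real_derivative (max 0 (min (env L \<tau>) (x \<tau>)) - 1) * max (-2) (min 2 (y \<tau>)) - d \<tau>) (at \<tau>)"
    and delta: "\<And>\<tau>. 0 < \<tau> \<Longrightarrow> \<tau> < T \<Longrightarrow> \<bar>\<delta> \<tau>\<bar> \<le> \<eta>"
    and d: "\<And>\<tau>. 0 < \<tau> \<Longrightarrow> \<tau> < T \<Longrightarrow> 0 \<le> d \<tau> \<and> d \<tau> \<le> D * \<gamma> * exp (- \<gamma> * \<tau>)"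
    and x0: "3/2 \<le> x 0" "x 0 \<le> 5/2"
    and y0: "3/2 * \<epsilon> \<le> y 0" "y 0 \<le> 5/2 * \<epsilon>"
    and eps: "0 < \<epsilon>" "\<epsilon> \<le> 1/100"
    and L: "5/2 * ln (1/\<epsilon>) + 300 \<le> L" and LT: "L + 8 \<le> T"
    and eta: "0 \<le> \<eta>" "\<eta> * L \<le> 1/1000"
    and D: "0 \<le> D" "D \<le> \<epsilon> / 10" and gamma: "1 \<le> \<gamma>"
begin

abbreviation z where "z \<tau> \<equiv> max 0 (min (env L \<tau>) (x \<tau>))"
abbreviation w where "w \<tau> \<equiv> max (-2) (min 2 (y \<tau>))"
definition V where "V \<tau> = (x \<tau> - 1)\<^sup>2 + (y \<tau>)\<^sup>2"

lemma L300: "300 \<le> L"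
proof -
  have "0 \<le> ln (1/\<epsilon>)" using eps by (intro ln_ge_zero) simp
  thus ?thesis using L by linarith
qed
lemma eta_small: "\<eta> \<le> 1/300000"
proof -
  have "\<eta> * 300 \<le> \<eta> * L" using L300 eta by (intro mult_left_mono) auto
  thus ?thesis using eta by simp
qed
lemma etaL: "0 \<le> \<tau> \<Longrightarrow> \<tau> \<le> L \<Longrightarrow> \<eta> * \<tau> \<le> 1/1000"
  using eta mult_left_mono[of \<tau> L \<eta>] by simp
lemma T0: "0 \<le> T" "L \<le> T" using L300 LT by auto
lemma D_small: "D \<le> 1/1000" using D eps by simp
lemma z_bounds: "0 \<le> z \<tau>" "z \<tau> \<le> 3" "z \<tau> \<le> env L \<tau>" using env_le_3[of L \<tau>] by auto

lemma sub_contx: "0 \<le> a \<Longrightarrow> b \<le> T \<Longrightarrow> continuous_on {a..b} x"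
  by (rule continuous_on_subset[OF contx]) auto
lemma sub_conty: "0 \<le> a \<Longrightarrow> b \<le> T \<Longrightarrow> continuous_on {a..b} y"
  by (rule continuous_on_subset[OF conty]) auto

lemma dz: "0 < \<tau> \<Longrightarrow> \<tau> < T \<Longrightarrow> \<bar>\<delta> \<tau> * z \<tau>\<bar> \<le> \<eta> * z \<tau>"
  using delta[of \<tau>] z_bounds(1)[of \<tau>] by (metis abs_mult abs_of_nonneg mult_right_mono)

lemma dz3: "0 < \<tau> \<Longrightarrow> \<tau> < T \<Longrightarrow> \<bar>\<delta> \<tau> * z \<tau>\<bar> \<le> 3 * \<eta>"
  using dz[of \<tau>] mult_left_mono[OF z_bounds(2)[of \<tau>] eta(1)] by linarith

lemma x_growth:
  assumes "0 \<le> a" "a \<le> b" "b \<le> T"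
  shows "x b \<le> x a + 3 * \<eta> * (b - a)"
proof -
  have "x b - (x a + 3 * \<eta> * (b - a)) \<le> 0"
  proof (rule barrier[where f = "\<lambda>r. x r - (x a + 3 * \<eta> * (r - a))" and C = 0 and \<kappa> = 1 and s = a])
    show "continuous_on {a..b} (\<lambda>r. x r - (x a + 3 * \<eta> * (r - a)))"
      using assms by (intro continuous_intros sub_contx)
    fix r assume r: "a < r" "r < b"
    have "((\<lambda>r. x r - (x a + 3 * \<eta> * (r - a))) has_real_derivative
            (\<delta> r * z r - (w r)\<^sup>2 - 3 * \<eta>)) (at r)"
      using r assms by (auto intro!: derivative_eq_intros derx)
    moreover have "\<delta> r * z r - (w r)\<^sup>2 - 3 * \<eta> \<le> 0"
      using dz3[of r] r assms zero_le_power2[of "w r"] by linarith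
    ultimately show "\<exists>D. ((\<lambda>r. x r - (x a + 3 * \<eta> * (r - a))) has_real_derivative D) (at r) \<and>
            D \<le> 0 * (x r - (x a + 3 * \<eta> * (r - a)))" by auto
  qed (use assms in auto)
  thus ?thesis by simp
qed

lemma x_drop:
  assumes "0 \<le> a" "a \<le> b" "b \<le> T"
  shows "x b \<ge> x a - 5 * (b - a)"
proof -
  have "(x a - 5 * (b - a)) - x b \<le> 0"
  proof (rule barrier[where f = "\<lambda>r. (x a - 5 * (r - a)) - x r" and C = 0 and \<kappa> = 1 and s = a])
    show "continuous_on {a..b} (\<lambda>r. (x a - 5 * (r - a)) - x r)"
      using assms by (intro continuous_intros sub_contx)
    fix r assume r: "a < r" "r < b"
    have "(w r)\<^sup>2 \<le> 2\<^sup>2" by (rule power2_le_iff_abs_le[THEN iffD2]) auto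
    then have "- 5 - (\<delta> r * z r - (w r)\<^sup>2) \<le> 0"
      using dz3[of r] eta_small r assms by simp
    moreover have "((\<lambda>r. (x a - 5 * (r - a)) - x r) has_real_derivative
            (- 5 - (\<delta> r * z r - (w r)\<^sup>2))) (at r)"
      using r assms by (auto intro!: derivative_eq_intros derx)
    ultimately show "\<exists>D. ((\<lambda>r. (x a - 5 * (r - a)) - x r) has_real_derivative D) (at r) \<and>
            D \<le> 0 * ((x a - 5 * (r - a)) - x r)" by auto
  qed (use assms in auto)
  thus ?thesis by simp
qed

lemma x_le_3: "0 \<le> \<tau> \<Longrightarrow> \<tau> \<le> L \<Longrightarrow> x \<tau> < 3"
  using x_growth[of 0 \<tau>] x0 etaL[of \<tau>] T0 by auto

lemma z_eq: "0 \<le> \<tau> \<Longrightarrow> \<tau> \<le> L \<Longrightarrow> 0 \<le> x \<tau> \<Longrightarrow> z \<tau> = x \<tau>"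
  using x_le_3[of \<tau>] by (simp add: env_before)

text \<open>The forcing is proportional to the clipped x and the flux to the killer only drains, so
  nothing can lift x through 0. This is the first of the two irreversible exits.\<close>

lemma x_stays_nonpos:
  assumes "0 \<le> a" "a \<le> b" "b \<le> T" "x a \<le> 0"
  shows "x b \<le> 0"
proof (rule barrier[where f = x and s = a and C = \<eta> and \<kappa> = 1])
  fix r assume r: "a < r" "r < b" "0 < x r"
  have "\<bar>\<delta> r * z r\<bar> \<le> \<eta> * x r"
    using dz[of r] r assms mult_left_mono[of "z r" "x r" \<eta>] eta by (auto simp: max_def)
  then have "\<delta> r * z r - (w r)\<^sup>2 \<le> \<eta> * x r" using zero_le_power2[of "w r"] by linarith
  then show "\<exists>D. (x has_real_derivative D) (at r) \<and> D \<le> \<eta> * x r"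
    using derx[of r] r assms by auto
next
  show "continuous_on {a..b} x" using assms by (intro sub_contx)
qed (use assms in auto)

section \<open>Approximate conservation of \<open>V\<close>\<close>

lemma V_der:
  assumes "0 < r" "r < T"
  shows "(V has_real_derivative 2 * (x r - 1) * (\<delta> r * z r - (w r)\<^sup>2) + 2 * y r * ((z r - 1) * w r - d r)) (at r)"
  unfolding V_def
  by (rule derivative_eq_intros derx[OF assms] dery[OF assms] refl | simp)+

text \<open>Where no clip acts, -2 (x - 1) y^2 and 2 y (x - 1) y cancel. Only forcing and drain
  remain, estimated with |x - 1| \<le> 2 and |y| \<le> 2.\<close>

lemma V_der_bound:
  assumes r: "0 < r" "r < L" and xr: "0 \<le> x r" and yr: "\<bar>y r\<bar> \<le> 2"
  obtains D' where "(V has_real_derivative D') (at r)" "\<bar>D'\<bar> \<le> 12 * \<eta> + 4 * D * \<gamma> * exp (- \<gamma> * r)"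
proof -
  have rT: "r < T" using r T0 by simp
  have z: "z r = x r" using z_eq[of r] r xr by simp
  have w: "w r = y r" using yr by auto
  have x3: "x r < 3" using x_le_3[of r] r by simp
  have e: "2 * (x r - 1) * (\<delta> r * z r - (w r)\<^sup>2) + 2 * y r * ((z r - 1) * w r - d r)
      = 2 * (x r - 1) * (\<delta> r * z r) - 2 * y r * d r"
    unfolding w unfolding z by (simp add: algebra_simps power2_eq_square)
  have 1: "\<bar>2 * (x r - 1) * (\<delta> r * z r)\<bar> \<le> 4 * (3 * \<eta>)"
    unfolding abs_mult[of "2 * (x r - 1)"] using xr x3 dz3[of r] r rT
    by (intro mult_mono) auto
  have 2: "\<bar>2 * y r * d r\<bar> \<le> 2 * 2 * (D * \<gamma> * exp (- \<gamma> * r))"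
    unfolding abs_mult using yr d[of r] r rT by (intro mult_mono) auto
  have "\<bar>2 * (x r - 1) * (\<delta> r * z r) - 2 * y r * d r\<bar> \<le> 12 * \<eta> + 4 * D * \<gamma> * exp (- \<gamma> * r)"
    using 1 2 by linarith
  with V_der[of r] r rT show thesis unfolding e by (intro that) auto
qed

text \<open>The circle \<open>(x - 1)\<^sup>2 + y\<^sup>2 = const\<close> is invariant under the unperturbed flow, whose orbits
  starting near \<open>(2, 0)\<close> separate into those reaching \<open>x < 0\<close> and those stopping at \<open>x > 0\<close>.\<close>

lemma V_upper:
  assumes s: "0 \<le> s" "s \<le> L" and pos: "\<And>r. 0 \<le> r \<Longrightarrow> r < s \<Longrightarrow> 0 \<le> x r"
  shows "V s \<le> V 0 + 1/50"
proof -
  \<comment> \<open>The integrated bound of \<open>V_der_bound\<close>: the pulse contributes at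
    most \<open>4 * D\<close>, however large \<open>\<gamma>\<close> is.\<close>
  define B where "B = (\<lambda>r. V 0 + 12 * \<eta> * r + 4 * D * (1 - exp (- \<gamma> * r)))"
  have Bb: "B r \<le> V 0 + 1/50" if "0 \<le> r" "r \<le> L" for r
  proof -
    have "4 * D * (1 - exp (- \<gamma> * r)) \<le> 4 * D * 1" using D by (intro mult_left_mono) auto
    thus ?thesis using etaL[of r] that D_small by (simp add: B_def)
  qed
  have "V s - B s \<le> 0"
  proof (rule barrier[where f = "\<lambda>r. V r - B r" and s = 0 and C = 0 and \<kappa> = 1])
    show "continuous_on {0..s} (\<lambda>r. V r - B r)" unfolding V_def B_def
      using s T0 by (intro continuous_intros sub_contx sub_conty) auto
    \<comment> \<open>Bootstrap: in the strip V exceeds \<open>B\<close> by less than 1, hence V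
      \<le> 4 and |y| \<le> 2, which is what \<open>V_der_bound\<close> requires.\<close>
    fix r assume r: "0 < r" "r < s" "V r - B r < 1"
    have "(x 0 - 1)\<^sup>2 \<le> (3/2)\<^sup>2" using x0 by (intro power_mono) auto
    moreover have "(y 0)\<^sup>2 \<le> (1/10)\<^sup>2" using y0 eps by (intro power_mono) auto
    ultimately have "V 0 \<le> 23/10" by (simp add: V_def power2_eq_square)
    then have "V r \<le> 4" using r(3) Bb[of r] r s by simp
    then have "(y r)\<^sup>2 \<le> 4" using zero_le_power2[of "x r - 1"] unfolding V_def by linarith
    then have "\<bar>y r\<bar> \<le> 2" using abs_le_square_iff[of "y r" 2] by simp
    then obtain D' where D': "(V has_real_derivative D') (at r)" "\<bar>D'\<bar> \<le> 12 * \<eta> + 4 * D * \<gamma> * exp (- \<gamma> * r)"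
      using V_der_bound[of r] r s pos[of r] by auto
    have "(B has_real_derivative 12 * \<eta> + 4 * D * \<gamma> * exp (- \<gamma> * r)) (at r)"
      unfolding B_def by (auto intro!: derivative_eq_intros)
    from DERIV_diff[OF D'(1) this] D'(2)
    show "\<exists>D. ((\<lambda>r. V r - B r) has_real_derivative D) (at r) \<and> D \<le> 0 * (V r - B r)"
      by (intro exI conjI) (assumption, simp)
  qed (use s in \<open>auto simp: B_def\<close>)
  thus ?thesis using Bb[of s] s by simp
qed

lemma V0: "V 0 \<le> 23/10" "1/4 \<le> V 0"
proof -
  have "(x 0 - 1)\<^sup>2 \<le> (3/2)\<^sup>2" using x0 by (intro power_mono) auto
  moreover have "(y 0)\<^sup>2 \<le> (1/10)\<^sup>2" using y0 eps by (intro power_mono) auto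
  ultimately show "V 0 \<le> 23/10" by (simp add: V_def power2_eq_square)
  have "(1/2)\<^sup>2 \<le> (x 0 - 1)\<^sup>2" using x0 by (intro power_mono) auto
  then show "1/4 \<le> V 0" unfolding V_def by (simp add: power2_eq_square add_increasing2)
qed

lemma y_le_16:
  assumes s: "0 \<le> s" "s \<le> L" and pos: "\<And>r. 0 \<le> r \<Longrightarrow> r < s \<Longrightarrow> 0 \<le> x r"
  shows "\<bar>y s\<bar> \<le> 8/5"
proof -
  have "V s \<le> (8/5)\<^sup>2" using V_upper[OF assms] V0 by (simp add: power2_eq_square)
  then have "(y s)\<^sup>2 \<le> (8/5)\<^sup>2" using zero_le_power2[of "x s - 1"] unfolding V_def by linarith
  then show ?thesis by (simp add: abs_le_square_iff[symmetric])
qed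

lemma V_lower:
  assumes s: "0 \<le> s" "s \<le> L" and pos: "\<And>r. 0 \<le> r \<Longrightarrow> r < s \<Longrightarrow> 0 \<le> x r"
  shows "V 0 - 1/50 \<le> V s"
proof -
  define B where "B = (\<lambda>r. V 0 - 12 * \<eta> * r - 4 * D * (1 - exp (- \<gamma> * r)))"
  have Bb: "B s \<ge> V 0 - 1/50"
  proof -
    have "4 * D * (1 - exp (- \<gamma> * s)) \<le> 4 * D * 1" using D by (intro mult_left_mono) auto
    thus ?thesis using etaL[of s] s D_small by (simp add: B_def)
  qed
  have "B s - V s \<le> 0"
  proof (rule barrier[where f = "\<lambda>r. B r - V r" and s = 0 and C = 0 and \<kappa> = 1])
    show "continuous_on {0..s} (\<lambda>r. B r - V r)" unfolding V_def B_def
      using s T0 by (intro continuous_intros sub_contx sub_conty) auto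
    fix r assume r: "0 < r" "r < s"
    have "\<bar>y r\<bar> \<le> 2" using y_le_16[of r] r s pos by force
    then obtain D' where D': "(V has_real_derivative D') (at r)" "\<bar>D'\<bar> \<le> 12 * \<eta> + 4 * D * \<gamma> * exp (- \<gamma> * r)"
      using V_der_bound[of r] r s pos[of r] by auto
    have "(B has_real_derivative - (12 * \<eta> + 4 * D * \<gamma> * exp (- \<gamma> * r))) (at r)"
      unfolding B_def by (auto intro!: derivative_eq_intros)
    from DERIV_diff[OF this D'(1)] D'(2)
    show "\<exists>D. ((\<lambda>r. B r - V r) has_real_derivative D) (at r) \<and> D \<le> 0 * (B r - V r)"
      by (intro exI conjI) (assumption, simp)
  qed (use s in \<open>auto simp: B_def\<close>)
  thus ?thesis using Bb by simp
qed

text \<open>The correction absorbs the drain \<open>d\<close>, so that \<open>yt\<close> has a one-sided differential inequality.\<close>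

definition yt where "yt \<tau> = y \<tau> - D * exp (- \<gamma> * \<tau>)"

lemma yt_der:
  assumes "0 < r" "r < T"
  obtains D' where "(yt has_real_derivative D') (at r)" "(z r - 1) * w r \<le> D'"
proof -
  have "(yt has_real_derivative ((z r - 1) * w r - d r - D * (exp (- \<gamma> * r) * (- \<gamma>)))) (at r)"
    unfolding yt_def by (rule derivative_eq_intros dery[OF assms] refl | simp)+
  moreover have "(z r - 1) * w r \<le> (z r - 1) * w r - d r - D * (exp (- \<gamma> * r) * (- \<gamma>))"
    using d[OF assms] by (simp add: mult_ac)
  ultimately show thesis by (rule that)
qed

lemma yt_le: "0 \<le> \<tau> \<Longrightarrow> yt \<tau> \<le> y \<tau> \<and> y \<tau> \<le> yt \<tau> + D"
proof -
  assume "0 \<le> \<tau>"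
  then have "D * exp (- \<gamma> * \<tau>) \<le> D * 1" using gamma D by (intro mult_left_mono) auto
  thus ?thesis using D by (simp add: yt_def)
qed

lemma cont_yt: "0 \<le> a \<Longrightarrow> b \<le> T \<Longrightarrow> continuous_on {a..b} yt"
  unfolding yt_def by (intro continuous_intros sub_conty)

text \<open>While \<open>x\<close> is bounded away from the turning point, a small \<open>y\<close> forces \<open>x \<ge> 7/5\<close>
  because of the conservation of \<open>V\<close>, so \<open>y\<close> grows exponentially.\<close>

lemma yt_growth_step:
  assumes s: "0 < r" "r \<le> L" and pos: "\<And>q. 0 \<le> q \<Longrightarrow> q \<le> r \<Longrightarrow> 3/5 \<le> x q"
    and small: "0 \<le> yt r" "yt r \<le> 1/10"
  obtains D' where "(yt has_real_derivative D') (at r)" "2/5 * yt r \<le> D'"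
proof -
  have y: "0 \<le> y r" "y r \<le> 101/1000" using small yt_le[of r] s D_small by auto
  have nn: "0 \<le> x q" if "0 \<le> q" "q \<le> r" for q using pos[OF that] by simp
  have "V 0 - 1/50 \<le> V r" using s nn by (intro V_lower) auto
  moreover have "(y r)\<^sup>2 \<le> (101/1000)\<^sup>2" using y by (intro power_mono) auto
  then have "(y r)\<^sup>2 \<le> 11/1000" by (simp add: power2_eq_square)
  ultimately have v: "21/100 \<le> (x r - 1)\<^sup>2" using V0 unfolding V_def by linarith
  \<comment> \<open>\<open>V\<close> leaves x at distance more than 2/5 from 1, and 3/5 \<le> x
    excludes the left arc of the circle.\<close>
  have x: "7/5 \<le> x r"
  proof (rule ccontr)
    assume "\<not> 7/5 \<le> x r"
    then have "\<bar>x r - 1\<bar> \<le> 2/5" using pos[OF less_imp_le[OF s(1)] order_refl] by linarith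
    then have "(x r - 1)\<^sup>2 \<le> (2/5)\<^sup>2" by (simp add: abs_le_square_iff[symmetric])
    then have "(x r - 1)\<^sup>2 \<le> 16/100" by (simp add: power2_eq_square)
    thus False using v by linarith
  qed
  have zr: "z r = x r" using z_eq[of r] s x by simp
  have wr: "w r = y r" using y by simp
  obtain D' where D': "(yt has_real_derivative D') (at r)" "(z r - 1) * w r \<le> D'"
    using yt_der[of r] s LT by auto
  have "2/5 * yt r \<le> 2/5 * y r" using yt_le[of r] s by simp
  also have "\<dots> \<le> (z r - 1) * w r" unfolding zr wr using x y by (intro mult_right_mono) auto
  finally have "2/5 * yt r \<le> D'" using D'(2) by linarith
  with D'(1) show thesis by (rule that)
qed

lemma yt_grows:
  assumes s: "0 \<le> s" "s \<le> L" and pos: "\<And>q. 0 \<le> q \<Longrightarrow> q \<le> s \<Longrightarrow> 3/5 \<le> x q"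
    and le: "\<epsilon> * exp (2/5 * s) \<le> 1/10"
  shows "\<epsilon> * exp (2/5 * s) \<le> yt s"
proof -
  have "\<epsilon> * exp (2/5 * s) - yt s \<le> 0"
  proof (rule barrier[where f = "\<lambda>r. \<epsilon> * exp (2/5 * r) - yt r" and s = 0 and C = "2/5" and \<kappa> = \<epsilon>])
    show "continuous_on {0..s} (\<lambda>r. \<epsilon> * exp (2/5 * r) - yt r)"
      using s T0 by (intro continuous_intros cont_yt) auto
    show "\<epsilon> * exp (2/5 * 0) - yt 0 \<le> 0" using y0 D eps by (simp add: yt_def)
    \<comment> \<open>The strip has width \<epsilon>, not more than the comparison function itself,
      so inside it \<open>yt\<close> is nonnegative as the growth step demands.\<close>
    fix r assume r: "0 < r" "r < s" "0 < \<epsilon> * exp (2/5 * r) - yt r" "\<epsilon> * exp (2/5 * r) - yt r < \<epsilon>"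
    have "\<epsilon> * 1 \<le> \<epsilon> * exp (2/5 * r)" using r eps by (intro mult_left_mono) auto
    then have a: "0 \<le> yt r" using r by linarith
    have "\<epsilon> * exp (2/5 * r) \<le> \<epsilon> * exp (2/5 * s)" using r eps by (intro mult_left_mono) auto
    then have b: "yt r \<le> 1/10" using r le by linarith
    have px: "3/5 \<le> x q" if "0 \<le> q" "q \<le> r" for q using that r pos by auto
    from yt_growth_step[of r, OF _ _ px a b]
    obtain D' where D': "(yt has_real_derivative D') (at r)" "2/5 * yt r \<le> D'"
      using r s by auto
    have "((\<lambda>r. \<epsilon> * exp (2/5 * r)) has_real_derivative \<epsilon> * (exp (2/5 * r) * (2/5))) (at r)"
      by (auto intro!: derivative_eq_intros)
    from DERIV_diff[OF this D'(1)] D'(2)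
    show "\<exists>D. ((\<lambda>r. \<epsilon> * exp (2/5 * r) - yt r) has_real_derivative D) (at r) \<and>
        D \<le> 2/5 * (\<epsilon> * exp (2/5 * r) - yt r)"
      by (intro exI conjI) (assumption, simp add: algebra_simps)
  qed (use s eps in auto)
  thus ?thesis by simp
qed

lemma yt_stays_large:
  assumes s: "0 \<le> a" "a \<le> s" "s \<le> L" and pos: "\<And>q. 0 \<le> q \<Longrightarrow> q \<le> s \<Longrightarrow> 3/5 \<le> x q"
    and ge: "1/10 \<le> yt a"
  shows "1/10 \<le> yt s"
proof -
  have "1/10 - yt s \<le> 0"
  proof (rule barrier[where f = "\<lambda>r. 1/10 - yt r" and s = a and C = 0 and \<kappa> = "1/10"])
    show "continuous_on {a..s} (\<lambda>r. 1/10 - yt r)"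
      using s T0 by (intro continuous_intros cont_yt) auto
    fix r assume r: "a < r" "r < s" "0 < 1/10 - yt r" "1/10 - yt r < 1/10"
    have px: "3/5 \<le> x q" if "0 \<le> q" "q \<le> r" for q using that r pos by auto
    from yt_growth_step[of r, OF _ _ px]
    obtain D' where D': "(yt has_real_derivative D') (at r)" "2/5 * yt r \<le> D'"
      using r s by auto
    from DERIV_diff[OF DERIV_const[of "1/10"] D'(1)] D'(2) r
    show "\<exists>D. ((\<lambda>r. 1/10 - yt r) has_real_derivative D) (at r) \<and> D \<le> 0 * (1/10 - yt r)"
      by (intro exI conjI) (assumption, simp)
  qed (use s ge in auto)
  thus ?thesis by simp
qed

text \<open>The time at which the lower bound \<open>\<epsilon> * exp (2/5 * \<tau>)\<close> reaches
  1/10; it is the origin of the logarithm in \<open>L\<close>.\<close>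

definition ta where "ta = 5/2 * ln (1 / (10 * \<epsilon>))"

lemma ta: "0 \<le> ta" "ta \<le> L - 300" "\<epsilon> * exp (2/5 * ta) = 1/10"
proof -
  have "ln (1 / (10 * \<epsilon>)) \<le> ln (1/\<epsilon>)" using eps by (intro ln_mono) (auto simp: field_simps)
  then show "ta \<le> L - 300" using L by (simp add: ta_def)
  show "0 \<le> ta" unfolding ta_def using eps by (intro mult_nonneg_nonneg ln_ge_zero) auto
  have "exp (2/5 * ta) = 1 / (10 * \<epsilon>)" using eps by (simp add: ta_def)
  then show "\<epsilon> * exp (2/5 * ta) = 1/10" using eps by simp
qed

text \<open>From \<open>ta\<close> on y \<ge> 1/10, so x falls at speed at least 99/10000. At least
  280 time units remain before \<open>L - 20\<close>, enough to bring x from below 3 to below 3/5.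
  The last 20 units are reserved for the decay of y.\<close>

lemma x_drops: "\<exists>\<tau>. 0 \<le> \<tau> \<and> \<tau> \<le> L - 20 \<and> x \<tau> \<le> 3/5"
proof (rule ccontr)
  assume "\<not> ?thesis"
  then have big: "3/5 < x q" if "0 \<le> q" "q \<le> L - 20" for q using that by force
  have a: "1/10 \<le> yt ta" using yt_grows[of ta] ta big by (auto simp: less_imp_le)
  have yb: "1/10 \<le> y r" if r: "ta \<le> r" "r \<le> L - 20" for r
  proof -
    have "1/10 \<le> yt r" using yt_stays_large[of ta r] a r ta big by (auto simp: less_imp_le)
    then show ?thesis using yt_le[of r] r ta by simp
  qed
  have "x (L - 20) - (x ta - 99/10000 * (L - 20 - ta)) \<le> 0"
  proof (rule barrier[where f = "\<lambda>r. x r - (x ta - 99/10000 * (r - ta))" and s = ta and C = 0 and \<kappa> = 1])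
    show "continuous_on {ta..L - 20} (\<lambda>r. x r - (x ta - 99/10000 * (r - ta)))"
      using ta T0 by (intro continuous_intros sub_contx) auto
    fix r assume r: "ta < r" "r < L - 20"
    have r': "0 < r" "r < T" using r ta T0 by auto
    have "(1/10)\<^sup>2 \<le> (w r)\<^sup>2" using yb[of r] r by (intro power_mono) auto
    then have "\<delta> r * z r - (w r)\<^sup>2 + 99/10000 \<le> 0"
      using dz3[OF r'] eta_small by (simp add: power2_eq_square abs_le_iff)
    moreover have "((\<lambda>r. x r - (x ta - 99/10000 * (r - ta))) has_real_derivative
        (\<delta> r * z r - (w r)\<^sup>2 + 99/10000)) (at r)"
      using derx[OF r'] by (auto intro!: derivative_eq_intros)
    ultimately show "\<exists>D. ((\<lambda>r. x r - (x ta - 99/10000 * (r - ta))) has_real_derivative D) (at r) \<and>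
            D \<le> 0 * (x r - (x ta - 99/10000 * (r - ta)))" by auto
  qed (use ta in auto)
  moreover have "x ta < 3" using x_le_3[of ta] ta by simp
  moreover have "99/10000 * 280 \<le> 99/10000 * (L - 20 - ta)" using ta(2) by (intro mult_left_mono) auto
  ultimately have "x (L - 20) < 3 - 99/10000 * 280" by linarith
  thus False using big[of "L - 20"] L300 by simp
qed

section \<open>Decay of the pair after x first passes 3/5\<close>

definition t1 where "t1 = (SOME \<tau>. 0 < \<tau> \<and> \<tau> \<le> L - 20 \<and> x \<tau> = 3/5 \<and> (\<forall>q. 0 \<le> q \<longrightarrow> q < \<tau> \<longrightarrow> 3/5 < x q))"

lemma t1: "0 < t1" "t1 \<le> L - 20" "x t1 = 3/5" "\<And>q. 0 \<le> q \<Longrightarrow> q < t1 \<Longrightarrow> 3/5 < x q"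
proof -
  obtain \<tau> where \<tau>: "0 \<le> \<tau>" "\<tau> \<le> L - 20" "x \<tau> \<le> 3/5" using x_drops by auto
  obtain r where "0 < r" "r \<le> \<tau>" "x r = 3/5" "\<And>q. 0 \<le> q \<Longrightarrow> q < r \<Longrightarrow> 3/5 < x q"
    using first_below[OF sub_contx[of 0 \<tau>], of "3/5"] \<tau> T0 x0 by auto
  then have "\<exists>\<tau>. 0 < \<tau> \<and> \<tau> \<le> L - 20 \<and> x \<tau> = 3/5 \<and> (\<forall>q. 0 \<le> q \<longrightarrow> q < \<tau> \<longrightarrow> 3/5 < x q)"
    using \<tau> by (intro exI[of _ r]) auto
  from someI_ex[OF this, folded t1_def]
  show "0 < t1" "t1 \<le> L - 20" "x t1 = 3/5" "\<And>q. 0 \<le> q \<Longrightarrow> q < t1 \<Longrightarrow> 3/5 < x q" by auto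
qed

text \<open>x cannot fall faster than speed 5. Keeping \<open>t1\<close> away from 0 ensures that
  the drain, whose initial height is not controlled, has faded by then.\<close>

lemma t1_lower: "1/10 \<le> t1" using x_drop[of 0 t1] t1 T0 x0 by simp

lemma env_der: "L < r \<Longrightarrow> (env L has_real_derivative (- env L r / 4)) (at r)"
proof -
  assume r: "L < r"
  have "((\<lambda>\<tau>. 3 * exp (- (\<tau> - L) / 4)) has_real_derivative (- env L r / 4)) (at r)"
    using r by (auto intro!: derivative_eq_intros simp: env_after)
  then show ?thesis
    by (rule has_field_derivative_transform_within_open[where S = "{L<..}"])
       (use r in \<open>auto simp: env_after\<close>)
qed

lemma x_after: assumes "t1 \<le> \<tau>" "\<tau> \<le> T" shows "x \<tau> \<le> 31/50"
proof -
  have A: "x r \<le> 61/100" if "t1 \<le> r" "r \<le> L" for r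
    using x_growth[of t1 r] that t1 T0 etaL[of "r - t1"] by auto
  show ?thesis
  proof (cases "\<tau> \<le> L")
    case True thus ?thesis using A[of \<tau>] assms by simp
  next
    case False
    \<comment> \<open>Since \<open>env\<close> decays at rate 1/4, \<open>4 * \<eta> * env\<close>
      is the total growth that the forcing can still cause; added to x it gives a nonincreasing
      quantity.\<close>
    have "(x \<tau> + 4 * \<eta> * env L \<tau>) - (61/100 + 4 * \<eta> * 3) \<le> 0"
    proof (rule barrier[where f = "\<lambda>\<tau>. (x \<tau> + 4 * \<eta> * env L \<tau>) - (61/100 + 4 * \<eta> * 3)" and s = L and C = 0 and \<kappa> = 1])
      show "continuous_on {L..\<tau>} (\<lambda>\<tau>. (x \<tau> + 4 * \<eta> * env L \<tau>) - (61/100 + 4 * \<eta> * 3))"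
        using assms L300 by (intro continuous_intros sub_contx) auto
      show "(x L + 4 * \<eta> * env L L) - (61/100 + 4 * \<eta> * 3) \<le> 0"
        using A[of L] t1 by (simp add: env_def)
      fix r assume r: "L < r" "r < \<tau>"
      then have r': "0 < r" "r < T" using assms L300 by auto
      have "\<delta> r * z r \<le> \<eta> * env L r"
        using dz[OF r'] mult_left_mono[OF z_bounds(3)[of r] eta(1)] by linarith
      then have "\<delta> r * z r - (w r)\<^sup>2 + 4 * \<eta> * (- env L r / 4) \<le> 0"
        using zero_le_power2[of "w r"] by linarith
      moreover have "((\<lambda>\<tau>. (x \<tau> + 4 * \<eta> * env L \<tau>) - (61/100 + 4 * \<eta> * 3)) has_real_derivative
         (\<delta> r * z r - (w r)\<^sup>2 + 4 * \<eta> * (- env L r / 4))) (at r)"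
        by (rule derivative_eq_intros derx[OF r'] env_der[OF r(1)] refl | simp)+
      ultimately show "\<exists>D. ((\<lambda>\<tau>. (x \<tau> + 4 * \<eta> * env L \<tau>) - (61/100 + 4 * \<eta> * 3)) has_real_derivative D) (at r) \<and>
          D \<le> 0 * ((x r + 4 * \<eta> * env L r) - (61/100 + 4 * \<eta> * 3))" by auto
    qed (use False in auto)
    moreover have "0 \<le> 4 * \<eta> * env L \<tau>" using eta by simp
    ultimately show ?thesis using eta_small by linarith
  qed
qed

lemma z_after: "t1 \<le> \<tau> \<Longrightarrow> \<tau> \<le> T \<Longrightarrow> z \<tau> \<le> 31/50"
  using x_after[of \<tau>] by auto

text \<open>From s exp (-s) \<le> 1 with s = \<open>\<gamma> * t1\<close> one gets
  \<open>\<gamma> * exp (- \<gamma> * t1)\<close> \<le> 1 / t1 \<le> 10, uniformly in \<gamma>. The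
  17/100 is a tenth of the constant in the decay estimate for y.\<close>

lemma d_after:
  assumes "t1 < r" "r < T" shows "d r \<le> 17/100 * exp (- (r - t1) / 5)"
proof -
  have "\<gamma> * t1 \<le> exp (\<gamma> * t1)" using exp_ge_add_one_self[of "\<gamma> * t1"] by linarith
  then have "\<gamma> * t1 * exp (- \<gamma> * t1) \<le> 1" by (simp add: exp_minus field_simps)
  moreover have "1/10 * (\<gamma> * exp (- \<gamma> * t1)) \<le> t1 * (\<gamma> * exp (- \<gamma> * t1))"
    using t1_lower gamma by (intro mult_right_mono) auto
  ultimately have g: "\<gamma> * exp (- \<gamma> * t1) \<le> 10" by (simp add: mult_ac)
  have "d r \<le> D * (\<gamma> * exp (- \<gamma> * t1)) * exp (- \<gamma> * (r - t1))"
    using d[of r] assms t1 by (simp add: exp_add[symmetric] algebra_simps)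
  also have "\<dots> \<le> 1/1000 * 10 * exp (- (r - t1) / 5)"
  proof (intro mult_mono g D_small)
    have "(r - t1) * 1 \<le> (r - t1) * (5 * \<gamma>)" using assms gamma by (intro mult_left_mono) auto
    then show "exp (- \<gamma> * (r - t1)) \<le> exp (- (r - t1) / 5)" by (simp add: field_simps)
  qed (use D gamma in auto)
  also have "\<dots> \<le> 17/100 * exp (- (r - t1) / 5)" by simp
  finally show ?thesis .
qed

text \<open>The linear rate z - 1 is now at most -19/50. The drain helps the upper barrier; in the
  lower one it costs at most a tenth of the comparison function \<open>g\<close>, and 19/50 - 1/10
  still exceeds 1/5. Since \<open>g\<close> \<le> 2, the clip of y does not weaken the damping at
  the barrier.\<close>

lemma y_decay:
  assumes "t1 \<le> \<tau>" "\<tau> \<le> T" shows "\<bar>y \<tau>\<bar> \<le> 17/10 * exp (- (\<tau> - t1) / 5)"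
proof -
  define g where "g = (\<lambda>\<tau>. 17/10 * exp (- (\<tau> - t1) / 5))"
  have gd: "(g has_real_derivative (- g r / 5)) (at r)" for r
    unfolding g_def by (auto intro!: derivative_eq_intros)
  have contg: "continuous_on S g" for S unfolding g_def by (intro continuous_intros) auto
  have g2: "0 < g r" "g r \<le> 2" if "t1 \<le> r" for r
  proof -
    have "exp (- (r - t1) / 5) \<le> 1" using that by simp
    then show "g r \<le> 2" unfolding g_def by linarith
    show "0 < g r" by (simp add: g_def)
  qed
  have y1: "\<bar>y t1\<bar> \<le> 8/5" using y_le_16[of t1] t1 by force
  have "y \<tau> - g \<tau> \<le> 0"
  proof (rule barrier[where f = "\<lambda>r. y r - g r" and s = t1 and C = 0 and \<kappa> = 1])
    show "continuous_on {t1..\<tau>} (\<lambda>r. y r - g r)"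
      using assms t1 by (intro continuous_intros sub_conty contg) auto
    show "y t1 - g t1 \<le> 0" using y1 by (simp add: g_def)
    fix r assume r: "t1 < r" "r < \<tau>" "0 < y r - g r"
    then have r': "0 < r" "r < T" using assms t1 by auto
    have w: "g r \<le> w r" using g2[of r] r by simp
    have "(1 - z r) * w r \<ge> 19/50 * g r"
      using z_after[of r] r assms w g2[of r] by (intro mult_mono) auto
    moreover have neg: "(z r - 1) * w r = - ((1 - z r) * w r)" by (simp only: algebra_simps)
    ultimately have le: "((z r - 1) * w r - d r) - (- g r / 5) \<le> 0"
      using d[OF r'] g2[of r] r unfolding neg by linarith
    from DERIV_diff[OF dery[OF r'] gd] le
    show "\<exists>D. ((\<lambda>r. y r - g r) has_real_derivative D) (at r) \<and> D \<le> 0 * (y r - g r)"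
      by (intro exI conjI) (assumption, simp)
  qed (use assms in auto)
  moreover have "- y \<tau> - g \<tau> \<le> 0"
  proof (rule barrier[where f = "\<lambda>r. - y r - g r" and s = t1 and C = 0 and \<kappa> = 1])
    show "continuous_on {t1..\<tau>} (\<lambda>r. - y r - g r)"
      using assms t1 by (intro continuous_intros sub_conty contg) auto
    show "- y t1 - g t1 \<le> 0" using y1 by (simp add: g_def)
    fix r assume r: "t1 < r" "r < \<tau>" "0 < - y r - g r"
    then have r': "0 < r" "r < T" using assms t1 by auto
    have w: "g r \<le> - w r" using g2[of r] r by simp
    have "(1 - z r) * (- w r) \<ge> 19/50 * g r"
      using z_after[of r] r assms w g2[of r] by (intro mult_mono) auto
    moreover have "d r \<le> 1/10 * g r" using d_after[of r] r assms by (simp add: g_def)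
    moreover have neg: "(z r - 1) * w r = (1 - z r) * (- w r)" by (simp only: algebra_simps)
    ultimately have le: "- ((z r - 1) * w r - d r) - (- g r / 5) \<le> 0"
      using g2[of r] r unfolding neg by linarith
    from DERIV_diff[OF DERIV_minus[OF dery[OF r']] gd] le
    show "\<exists>D. ((\<lambda>r. - y r - g r) has_real_derivative D) (at r) \<and> D \<le> 0 * (- y r - g r)"
      by (intro exI conjI) (assumption, simp)
  qed (use assms in auto)
  ultimately show ?thesis unfolding g_def by linarith
qed

lemma y_le_2: assumes "0 \<le> \<tau>" "\<tau> \<le> T" shows "\<bar>y \<tau>\<bar> \<le> 2"
proof (cases "\<tau> \<le> t1")
  case True
  have "0 \<le> x r" if "0 \<le> r" "r < \<tau>" for r using t1(4)[of r] that True by simp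
  then show ?thesis using y_le_16[of \<tau>] assms True t1 by force
next
  case False
  then have "exp (- (\<tau> - t1) / 5) \<le> 1" by simp
  then show ?thesis using y_decay[of \<tau>] False assms by linarith
qed

lemma y_sq_late:
  assumes "L \<le> \<tau>" "\<tau> \<le> T" shows "(y \<tau>)\<^sup>2 \<le> 1/100 * exp (- (\<tau> - L) * 2 / 5)"
proof -
  \<comment> \<open>The 20 units between \<open>t1\<close> and \<open>L\<close> at rate 1/5; this
    turns the constant 17/10 into 1/10.\<close>
  have e4: "exp (-4::real) \<le> 1/17"
  proof -
    have "(17::real) \<le> 2 ^ 5" by simp
    have "(exp (1::real)) ^ 4 \<ge> (5/2) ^ 4" by (intro power_mono) (use e_approx_32 in \<open>auto simp: abs_if split: if_splits\<close>)
    moreover have "(exp (1::real)) ^ 4 = exp 4" using exp_of_nat_mult[of 4 "1::real"] by simp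
    ultimately have "exp (4::real) \<ge> 17" by (simp add: power_numeral_reduce)
    then show ?thesis by (simp add: exp_minus field_simps)
  qed
  moreover have "exp (- (\<tau> - t1) / 5) \<le> exp (-4) * exp (- (\<tau> - L) / 5)"
    using t1 by (simp add: exp_add[symmetric] field_simps)
  ultimately have "exp (- (\<tau> - t1) / 5) \<le> 1/17 * exp (- (\<tau> - L) / 5)"
    using mult_right_mono[OF e4 exp_ge_zero, of "- (\<tau> - L) / 5"] by linarith
  then have "\<bar>y \<tau>\<bar> \<le> 1/10 * exp (- (\<tau> - L) / 5)"
    using y_decay[of \<tau>] assms t1 by simp
  then have "\<bar>y \<tau>\<bar>\<^sup>2 \<le> (1/10 * exp (- (\<tau> - L) / 5))\<^sup>2" by (intro power_mono) auto
  also have "\<dots> = 1/100 * (exp (- (\<tau> - L) / 5) * exp (- (\<tau> - L) / 5))" by (simp add: power2_eq_square)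
  also have "exp (- (\<tau> - L) / 5) * exp (- (\<tau> - L) / 5) = exp (- (\<tau> - L) * 2 / 5)"
    unfolding mult_exp_exp by (rule arg_cong[of _ _ exp]) simp
  finally show ?thesis by simp
qed

lemma y_sq_env:
  assumes "L \<le> \<tau>" "\<tau> \<le> T" shows "(y \<tau>)\<^sup>2 \<le> 1/100 * env L \<tau>"
proof -
  have "exp (- (\<tau> - L) * 2 / 5) \<le> exp (- (\<tau> - L) / 4)" using assms by simp
  also have "\<dots> \<le> env L \<tau>" using assms by (simp add: env_after)
  finally show ?thesis using y_sq_late[OF assms] by simp
qed

section \<open>The possible fates of a killed mode\<close>

lemma w_sq_le: "(w \<tau>)\<^sup>2 \<le> (y \<tau>)\<^sup>2"
  by (rule abs_le_square_iff[THEN iffD1]) auto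

text \<open>The second irreversible exit: after \<open>L\<close> the loss of x is at most about
  \<open>env\<close> / 100 per unit time, while the envelope itself sinks at speed
  \<open>env\<close> / 4.\<close>

lemma x_stays_above:
  assumes "L \<le> a" "a \<le> b" "b \<le> T" "env L a \<le> x a"
  shows "env L b \<le> x b"
proof -
  have "env L b - x b \<le> 0"
  proof (rule barrier[where f = "\<lambda>r. env L r - x r" and s = a and C = 0 and \<kappa> = 1])
    show "continuous_on {a..b} (\<lambda>r. env L r - x r)"
      using assms L300 by (intro continuous_intros sub_contx) auto
    fix r assume r: "a < r" "r < b"
    then have r': "0 < r" "r < T" "L < r" using assms L300 by auto
    have 1: "(w r)\<^sup>2 \<le> 1/100 * env L r"
      using w_sq_le[of r] y_sq_env[of r] r' by simp
    have 2: "\<bar>\<delta> r * z r\<bar> \<le> \<eta> * env L r"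
      using dz[OF r'(1,2)] mult_left_mono[OF z_bounds(3)[of r] eta(1)] by linarith
    have 3: "\<eta> * env L r \<le> 1/300000 * env L r" using eta_small by (intro mult_right_mono) auto
    have le: "- env L r / 4 - (\<delta> r * z r - (w r)\<^sup>2) \<le> 0"
      using 1 2 3 env_pos[of L r] by linarith
    from DERIV_diff[OF env_der[OF r'(3)] derx[OF r'(1,2)]] le
    show "\<exists>D. ((\<lambda>r. env L r - x r) has_real_derivative D) (at r) \<and> D \<le> 0 * (env L r - x r)"
      by (intro exI conjI) (assumption, simp)
  qed (use assms in auto)
  thus ?thesis by simp
qed

text \<open>As both exits are irreversible, a condition at the final time alone controls the whole
  trajectory, so the shooting has one scalar condition per killed mode.\<close>

lemma survivor:
  assumes "0 < x T" "x T < env L T" "0 \<le> \<tau>" "\<tau> \<le> T"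
  shows "0 < x \<tau>" "x \<tau> \<le> env L \<tau>"
proof -
  show p: "0 < x \<tau>" using x_stays_nonpos[of \<tau> T] assms by force
  show q: "x \<tau> \<le> env L \<tau>"
  proof (cases "\<tau> \<le> L")
    case True thus ?thesis using x_le_3[of \<tau>] assms by (simp add: env_before)
  next
    case False thus ?thesis using x_stays_above[of \<tau> T] assms by force
  qed
qed

text \<open>The circle of radius about 3/2 around (1, 0) reaches x < 0. If x stayed positive, then
  at time \<open>L\<close> y would be small and 0 < x \<le> 31/50, which is incompatible with
  \<open>V\<close> being near 9/4.\<close>

lemma high_start: assumes "x 0 = 5/2" shows "x T \<le> 0"
proof -
  have "\<exists>r. 0 \<le> r \<and> r \<le> L \<and> x r \<le> 0"
  proof (rule ccontr)
    assume "\<not> ?thesis"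
    then have pos: "0 < x r" if "0 \<le> r" "r \<le> L" for r using that by force
    have "V 0 - 1/50 \<le> V L" using L300 pos by (intro V_lower) (auto simp: less_imp_le)
    moreover have "(x 0 - 1)\<^sup>2 = 9/4" unfolding assms by (simp add: power2_eq_square)
    then have "V 0 \<ge> 9/4" using zero_le_power2[of "y 0"] unfolding V_def by linarith
    moreover have "(y L)\<^sup>2 \<le> 1/100" using y_sq_late[of L] T0 by simp
    ultimately have "1 \<le> (x L - 1)\<^sup>2" unfolding V_def by linarith
    moreover have "\<bar>x L - 1\<bar> < 1" using pos[of L] x_after[of L] t1 T0 L300 by auto
    then have "\<bar>x L - 1\<bar>\<^sup>2 < 1" using power_Suc_less_one[of "\<bar>x L - 1\<bar>" 1]
      by (cases "x L = 1") (auto simp: power2_eq_square abs_mult_less)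
    ultimately show False by simp
  qed
  then show ?thesis using x_stays_nonpos[of _ T] T0 by auto
qed

text \<open>The circle of radius about 1/2 around (1, 0) stays away from x = 0, so x comes to rest
  at a positive level that the decaying envelope passes.\<close>

lemma low_start: assumes "x 0 = 3/2" shows "env L T \<le> x T"
proof -
  have V0': "V 0 \<le> 13/50"
  proof -
    have "(y 0)\<^sup>2 \<le> (1/10)\<^sup>2" using y0 eps by (intro power_mono) auto
    moreover have "(1/10)\<^sup>2 = (1/100::real)" by (simp add: power2_eq_square)
    moreover have "(x 0 - 1)\<^sup>2 = 1/4" unfolding assms by (simp add: power2_eq_square)
    ultimately show ?thesis unfolding V_def by linarith
  qed
  \<comment> \<open>Positivity is asked only strictly before \<open>s\<close>, so this can be
    applied at a first zero of x, which it refutes.\<close>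
  have key: "9/20 \<le> x s" if s: "0 \<le> s" "s \<le> L" and pos: "\<And>r. 0 \<le> r \<Longrightarrow> r < s \<Longrightarrow> 0 \<le> x r" for s
  proof (rule ccontr)
    assume "\<not> 9/20 \<le> x s"
    then have "(11/20)\<^sup>2 \<le> (1 - x s)\<^sup>2" by (intro power_mono) auto
    moreover have "(11/20)\<^sup>2 = (121/400::real)" by (simp add: power2_eq_square)
    ultimately have "121/400 \<le> (x s - 1)\<^sup>2" by (subst power2_commute) (simp add: power2_eq_square)
    moreover have "V s \<le> V 0 + 1/50" using V_upper[of s] s pos by auto
    ultimately show False using V0' zero_le_power2[of "y s"] unfolding V_def by linarith
  qed
  have xL: "9/20 \<le> x L"
  proof (cases "\<exists>r. 0 \<le> r \<and> r \<le> L \<and> x r \<le> 0")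
    case True
    then obtain r0 where r0: "0 \<le> r0" "r0 \<le> L" "x r0 \<le> 0" by auto
    obtain r where "0 < r" "r \<le> r0" "x r = 0" "\<And>q. 0 \<le> q \<Longrightarrow> q < r \<Longrightarrow> 0 < x q"
      using first_below[OF sub_contx[of 0 r0], of 0] r0 T0 x0 by auto
    then show ?thesis using key[of r] r0 by (force simp: less_imp_le)
  next
    case False
    then have "0 \<le> x r" if "0 \<le> r" "r \<le> L" for r using that by force
    then show ?thesis using key[of L] L300 by auto
  qed
  \<comment> \<open>The two correction terms are the remaining integrals of the bounds for the
    forcing and for the flux: \<open>env\<close> integrates to 4 times itself, and (1/100) / (2/5) =
    1/40.\<close>
  have "(9/20 - 4 * \<eta> * 3 - 1/40) - (x T - 4 * \<eta> * env L T - 1/40 * exp (- (T - L) * 2 / 5)) \<le> 0"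
  proof (rule barrier[where f = "\<lambda>r. (9/20 - 4 * \<eta> * 3 - 1/40) - (x r - 4 * \<eta> * env L r - 1/40 * exp (- (r - L) * 2 / 5))" and s = L and C = 0 and \<kappa> = 1])
    show "continuous_on {L..T} (\<lambda>r. (9/20 - 4 * \<eta> * 3 - 1/40) - (x r - 4 * \<eta> * env L r - 1/40 * exp (- (r - L) * 2 / 5)))"
      using L300 by (intro continuous_intros sub_contx) auto
    show "(9/20 - 4 * \<eta> * 3 - 1/40) - (x L - 4 * \<eta> * env L L - 1/40 * exp (- (L - L) * 2 / 5)) \<le> 0"
      using xL by (simp add: env_def)
    fix r assume r: "L < r" "r < T"
    then have r': "0 < r" "r < T" using L300 by auto
    have 1: "(w r)\<^sup>2 \<le> 1/100 * exp (- (r - L) * 2 / 5)"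
      using w_sq_le[of r] y_sq_late[of r] r by linarith
    have 2: "\<bar>\<delta> r * z r\<bar> \<le> \<eta> * env L r"
      using dz[OF r'(1,2)] mult_left_mono[OF z_bounds(3)[of r] eta(1)] by linarith
    have le: "0 - (\<delta> r * z r - (w r)\<^sup>2 - 4 * \<eta> * (- env L r / 4) - 1/40 * (exp (- (r - L) * 2 / 5) * (- 2/5))) \<le> 0"
      using 1 2 by (simp add: algebra_simps)
    have "((\<lambda>r. (9/20 - 4 * \<eta> * 3 - 1/40) - (x r - 4 * \<eta> * env L r - 1/40 * exp (- (r - L) * 2 / 5)))
      has_real_derivative 0 - (\<delta> r * z r - (w r)\<^sup>2 - 4 * \<eta> * (- env L r / 4) - 1/40 * (exp (- (r - L) * 2 / 5) * (- 2/5)))) (at r)"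
      by (rule derivative_eq_intros derx[OF r'] env_der[OF r(1)] refl | simp)+
    with le show "\<exists>D. ((\<lambda>r. (9/20 - 4 * \<eta> * 3 - 1/40) - (x r - 4 * \<eta> * env L r - 1/40 * exp (- (r - L) * 2 / 5))) has_real_derivative D) (at r) \<and>
         D \<le> 0 * ((9/20 - 4 * \<eta> * 3 - 1/40) - (x r - 4 * \<eta> * env L r - 1/40 * exp (- (r - L) * 2 / 5)))"
      by auto
  qed (use T0 in auto)
  moreover have "0 \<le> 4 * \<eta> * env L T" using eta by simp
  moreover have "0 < exp (- (T - L) * 2 / 5)" by simp
  ultimately have "21/50 \<le> x T" using eta_small by linarith
  moreover have "env L T \<le> 21/50"
  proof -
    have "exp (- (T - L) / 4) \<le> exp (-2)" using LT by simp
    moreover have "exp (-2::real) \<le> 7/50"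
    proof -
      have "(exp (1::real)) ^ 2 \<ge> (271/100) ^ 2"
        by (intro power_mono) (use e_approx_32 in \<open>auto simp: abs_if split: if_splits\<close>)
      moreover have "(exp (1::real)) ^ 2 = exp 2" using exp_of_nat_mult[of 2 "1::real"] by simp
      ultimately have "exp (2::real) \<ge> 50/7" by (simp add: power2_eq_square)
      then show ?thesis by (simp add: exp_minus field_simps)
    qed
    ultimately show ?thesis unfolding env_after[OF T0(2)] by linarith
  qed
  ultimately show ?thesis by simp
qed

end

section \<open>Bounded Lipschitz systems of differential equations\<close>

lemma integral_has_real_derivative_Ici:
  fixes g :: "real \<Rightarrow> real"
  assumes g: "continuous_on {0..} g" and t: "0 \<le> t"
  shows "((\<lambda>x. integral {0..x} g) has_real_derivative g t) (at t within {0..})"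
proof -
  have "((\<lambda>x. integral {0..x} g) has_real_derivative g t) (at t within {0..t+1})"
    using t by (intro integral_has_real_derivative continuous_on_subset[OF g]) auto
  moreover have "at t within {0..t+1} = at t within {0..}"
    by (rule at_within_nhd[of _ "{..<t+1}"]) auto
  ultimately show ?thesis by simp
qed

text \<open>With the weight \<open>exp (2 * K * t)\<close> the Picard operator contracts by 1/2 on
  the whole half-line, so no iteration over short time intervals is needed.\<close>

lemma abs_integral_le_exp:
  fixes g :: "real \<Rightarrow> real"
  assumes g: "continuous_on {0..} g" and t: "0 \<le> t" and K: "0 < K"
    and le: "\<And>s. 0 \<le> s \<Longrightarrow> s \<le> t \<Longrightarrow> \<bar>g s\<bar> \<le> K * B * exp (2 * K * s)"
  shows "\<bar>integral {0..t} g\<bar> \<le> B / 2 * (exp (2 * K * t) - 1)"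
proof -
  have h: "((\<lambda>s. K * B * exp (2 * K * s)) has_integral (B / 2 * exp (2 * K * t) - B / 2 * exp (2 * K * 0))) {0..t}"
    by (rule fundamental_theorem_of_calculus[OF t])
       (auto intro!: derivative_eq_intros simp: has_real_derivative_iff_has_vector_derivative[symmetric])
  have "norm (integral {0..t} g) \<le> integral {0..t} (\<lambda>s. K * B * exp (2 * K * s))"
    by (rule integral_norm_bound_integral)
       (use le has_integral_integrable[OF h] in \<open>auto intro!: integrable_continuous_interval continuous_on_subset[OF g]\<close>)
  also have "\<dots> = B / 2 * (exp (2 * K * t) - 1)"
    using integral_unique[OF h] by (simp add: algebra_simps)
  finally show ?thesis by simp
qed

text \<open>States keep infinitely many components and are compared by uniform bounds on them, so
  one flow serves all truncations. The bound \<open>M\<close> controls the first Picard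
  step.\<close>

locale bounded_lipschitz_ode =
  fixes f :: "real \<Rightarrow> (nat \<Rightarrow> real) \<Rightarrow> nat \<Rightarrow> real" and K M :: real
  assumes K: "0 < K"
    and lip: "\<And>t X Y B j. 0 \<le> t \<Longrightarrow> (\<And>i. \<bar>X i - Y i\<bar> \<le> B) \<Longrightarrow> \<bar>f t X j - f t Y j\<bar> \<le> K * B"
    and cont: "\<And>X j. (\<And>i. continuous_on {0..} (\<lambda>t. X t i)) \<Longrightarrow> continuous_on {0..} (\<lambda>t. f t (X t) j)"
    and bound: "\<And>t X j. 0 \<le> t \<Longrightarrow> \<bar>f t X j\<bar> \<le> M"
begin

fun picard :: "nat \<Rightarrow> (nat \<Rightarrow> real) \<Rightarrow> real \<Rightarrow> nat \<Rightarrow> real" where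
  "picard 0 p t j = p j"
| "picard (Suc m) p t j = p j + integral {0..t} (\<lambda>s. f s (picard m p s) j)"

lemma picard_cont: "continuous_on {0..} (\<lambda>t. picard m p t j)"
proof (induction m arbitrary: j)
  case (Suc m)
  have "continuous_on {0..} (\<lambda>t. f t (picard m p t) j)" by (rule cont[OF Suc])
  from DERIV_continuous_on[OF integral_has_real_derivative_Ici[OF this]]
  show ?case by (auto intro!: continuous_intros)
qed auto

lemma f_picard_cont: "continuous_on {0..} (\<lambda>t. f t (picard m p t) j)"
  by (rule cont[OF picard_cont])

lemma picard_step: "0 \<le> t \<Longrightarrow> \<bar>picard (Suc m) p t j - picard m p t j\<bar> \<le> M / (2*K) * (1/2)^m * exp (2*K*t)"
proof (induction m arbitrary: t j)
  case 0
  have "\<bar>integral {0..t} (\<lambda>s. f s (picard 0 p s) j)\<bar> \<le> M * (t - 0)"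
    using integral_bound[of 0 t "\<lambda>s. f s (picard 0 p s) j" M] 0 bound
      continuous_on_subset[OF f_picard_cont[of 0 p j], of "{0..t}"] by auto
  also have "\<dots> \<le> M / (2*K) * exp (2*K*t)"
  proof -
    have "2*K*t \<le> exp (2*K*t)" using exp_ge_add_one_self[of "2*K*t"] by linarith
    moreover have "0 \<le> M" using bound[of 0 "\<lambda>_. 0" 0] by simp
    ultimately have "M / (2*K) * (2*K*t) \<le> M / (2*K) * exp (2*K*t)"
      using K by (intro mult_left_mono) auto
    then show ?thesis using K by simp
  qed
  finally show ?case by (simp del: picard.simps(1) add: picard.simps(1)[of p t j])
next
  case (Suc m)
  have "\<bar>integral {0..t} (\<lambda>s. f s (picard (Suc m) p s) j - f s (picard m p s) j)\<bar>
      \<le> (M / (2*K) * (1/2)^m) / 2 * (exp (2 * K * t) - 1)"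
  proof (rule abs_integral_le_exp[OF _ Suc.prems K])
    show "continuous_on {0..} (\<lambda>s. f s (picard (Suc m) p s) j - f s (picard m p s) j)"
      by (intro continuous_intros f_picard_cont)
    fix s :: real assume s: "0 \<le> s"
    show "\<bar>f s (picard (Suc m) p s) j - f s (picard m p s) j\<bar> \<le> K * (M / (2 * K) * (1 / 2) ^ m) * exp (2 * K * s)"
      using lip[of s "picard (Suc m) p s" "picard m p s", OF s Suc.IH[OF s]] by (simp only: mult.assoc)
  qed
  also have "integral {0..t} (\<lambda>s. f s (picard (Suc m) p s) j - f s (picard m p s) j)
     = picard (Suc (Suc m)) p t j - picard (Suc m) p t j"
    unfolding picard.simps(2)[of "Suc m"] picard.simps(2)[of m p t j]
    by (subst Henstock_Kurzweil_Integration.integral_diff)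
       (auto intro!: integrable_continuous_interval continuous_on_subset[OF f_picard_cont] simp del: picard.simps)
  also have "(M / (2*K) * (1/2)^m) / 2 * (exp (2 * K * t) - 1) \<le> (M / (2*K) * (1/2)^m) / 2 * exp (2 * K * t)"
    using K bound[of 0 "\<lambda>_. 0" 0] by (intro mult_left_mono) auto
  finally show ?case by simp
qed

definition flow :: "(nat \<Rightarrow> real) \<Rightarrow> real \<Rightarrow> nat \<Rightarrow> real" where
  "flow p t j = lim (\<lambda>m. picard m p t j)"

lemma M_nonneg: "0 \<le> M" using bound[of 0 "\<lambda>_. 0" 0] by simp

lemma picard_diff:
  assumes "0 \<le> t" shows "\<bar>picard (m + n) p t j - picard m p t j\<bar> \<le> M / K * (1/2)^m * exp (2*K*t)"
proof -
  have "\<bar>picard (m + n) p t j - picard m p t j\<bar> \<le> M / K * (1/2)^m * exp (2*K*t) * (1 - (1/2)^n)"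
  proof (induction n)
    case (Suc n)
    have "\<bar>picard (m + Suc n) p t j - picard m p t j\<bar>
      \<le> \<bar>picard (Suc (m + n)) p t j - picard (m+n) p t j\<bar> + \<bar>picard (m + n) p t j - picard m p t j\<bar>"
      by (simp del: picard.simps)
    also have "\<dots> \<le> M / (2*K) * (1/2)^(m+n) * exp (2*K*t) + M / K * (1/2)^m * exp (2*K*t) * (1 - (1/2)^n)"
      by (intro add_mono picard_step Suc.IH assms)
    also have "\<dots> = M / K * (1/2)^m * exp (2*K*t) * (1 - (1/2)^Suc n)"
      using K by (simp add: field_simps power_add)
    finally show ?case .
  qed auto
  also have "\<dots> \<le> M / K * (1/2)^m * exp (2*K*t) * 1"
    using M_nonneg K by (intro mult_left_mono) auto
  finally show ?thesis by simp
qed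

lemma picard_tendsto:
  assumes "0 \<le> t" shows "(\<lambda>m. picard m p t j) \<longlonglongrightarrow> flow p t j"
proof -
  have z: "(\<lambda>m. M / K * (1/2)^m * exp (2*K*t)) \<longlonglongrightarrow> 0"
    by (rule tendsto_eq_intros LIMSEQ_power_zero | simp)+
  have "Cauchy (\<lambda>m. picard m p t j)"
  proof (rule CauchyI')
    fix e :: real assume "0 < e"
    with order_tendstoD(2)[OF z] obtain N where N: "\<And>m. m \<ge> N \<Longrightarrow> M / K * (1/2)^m * exp (2*K*t) < e"
      by (auto simp: eventually_sequentially)
    have "dist (picard m p t j) (picard n p t j) < e" if "N \<le> m" "m < n" for m n
      using picard_diff[OF assms, of m "n - m" p j] N[of m] that by (simp add: dist_real_def abs_minus_commute del: picard.simps)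
    then show "\<exists>N. \<forall>m\<ge>N. \<forall>n>m. dist (picard m p t j) (picard n p t j) < e" by blast
  qed
  then show ?thesis unfolding flow_def by (simp add: Cauchy_convergent_iff convergent_LIMSEQ_iff)
qed

lemma flow_picard:
  assumes "0 \<le> t" shows "\<bar>flow p t j - picard m p t j\<bar> \<le> M / K * (1/2)^m * exp (2*K*t)"
proof (rule LIMSEQ_le_const2)
  show "(\<lambda>n. \<bar>picard (n + m) p t j - picard m p t j\<bar>) \<longlonglongrightarrow> \<bar>flow p t j - picard m p t j\<bar>"
    by (intro tendsto_intros LIMSEQ_ignore_initial_segment picard_tendsto assms)
  show "\<exists>N. \<forall>n\<ge>N. \<bar>picard (n + m) p t j - picard m p t j\<bar> \<le> M / K * (1/2)^m * exp (2*K*t)"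
    by (intro exI[of _ 0] allI impI) (use picard_diff[OF assms, of m] in \<open>simp only: add.commute\<close>)
qed

lemma flow_cont: "continuous_on {0..} (\<lambda>t. flow p t j)"
proof -
  have "continuous_on {0..b} (\<lambda>t. flow p t j)" for b
  proof (rule uniform_limit_theorem[where F = sequentially])
    show "\<forall>\<^sub>F n in sequentially. continuous_on {0..b} (\<lambda>t. picard n p t j)"
      by (intro always_eventually allI continuous_on_subset[OF picard_cont]) auto
    show "uniform_limit {0..b} (\<lambda>n t. picard n p t j) (\<lambda>t. flow p t j) sequentially"
    proof (rule uniform_limitI)
      fix e :: real assume "0 < e"
      have z: "(\<lambda>m. M / K * (1/2)^m * exp (2*K*b)) \<longlonglongrightarrow> 0"
        by (rule tendsto_eq_intros LIMSEQ_power_zero | simp)+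
      from order_tendstoD(2)[OF z \<open>0 < e\<close>]
      show "\<forall>\<^sub>F n in sequentially. \<forall>t\<in>{0..b}. dist (picard n p t j) (flow p t j) < e"
      proof eventually_elim
        case (elim m)
        show ?case
        proof
          fix t assume t: "t \<in> {0..b}"
          have "\<bar>flow p t j - picard m p t j\<bar> \<le> M / K * (1/2)^m * exp (2*K*t)"
            using flow_picard t by auto
          also have "\<dots> \<le> M / K * (1/2)^m * exp (2*K*b)"
            using t K M_nonneg by (intro mult_left_mono) auto
          finally show "dist (picard m p t j) (flow p t j) < e" using elim by (simp add: dist_real_def abs_minus_commute)
        qed
      qed
    qed
  qed auto
  moreover have "at t within {0..t+1} = at t within {0..}" if "0 \<le> t" for t :: real
    using that by (intro at_within_nhd[of _ "{..<t+1}"]) auto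
  ultimately show ?thesis
    unfolding continuous_on_eq_continuous_within by (metis atLeastAtMost_iff atLeast_iff le_add_same_cancel1 zero_le_one)
qed

lemma flow_integral:
  assumes t: "0 \<le> t" shows "flow p t j = p j + integral {0..t} (\<lambda>s. f s (flow p s) j)"
proof (rule LIMSEQ_unique)
  show "(\<lambda>m. picard (Suc m) p t j) \<longlonglongrightarrow> flow p t j"
    by (rule LIMSEQ_Suc[OF picard_tendsto[OF t]])
  have fc: "continuous_on {0..} (\<lambda>s. f s (flow p s) j)" by (rule cont[OF flow_cont])
  have b: "\<bar>integral {0..t} (\<lambda>s. f s (flow p s) j - f s (picard m p s) j)\<bar>
      \<le> (M / K * (1/2)^m) / 2 * (exp (2 * K * t) - 1)" for m
  proof (rule abs_integral_le_exp[OF _ t K])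
    show "continuous_on {0..} (\<lambda>s. f s (flow p s) j - f s (picard m p s) j)"
      by (intro continuous_intros f_picard_cont fc)
    fix s :: real assume s: "0 \<le> s"
    show "\<bar>f s (flow p s) j - f s (picard m p s) j\<bar> \<le> K * (M / K * (1 / 2) ^ m) * exp (2 * K * s)"
      using lip[of s "flow p s" "picard m p s", OF s flow_picard[OF s]] by (simp only: mult.assoc)
  qed
  have "(\<lambda>m. integral {0..t} (\<lambda>s. f s (flow p s) j - f s (picard m p s) j)) \<longlonglongrightarrow> 0"
  proof (rule Lim_null_comparison)
    show "\<forall>\<^sub>F m in sequentially. norm (integral {0..t} (\<lambda>s. f s (flow p s) j - f s (picard m p s) j))
       \<le> (M / K * (1/2)^m) / 2 * (exp (2 * K * t) - 1)"
      using b by simp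
    show "(\<lambda>m. (M / K * (1/2)^m) / 2 * (exp (2 * K * t) - 1)) \<longlonglongrightarrow> 0"
      by (rule tendsto_eq_intros LIMSEQ_power_zero | simp)+
  qed
  from tendsto_diff[OF tendsto_const[of "p j + integral {0..t} (\<lambda>s. f s (flow p s) j)"] this]
  show "(\<lambda>m. picard (Suc m) p t j) \<longlonglongrightarrow> p j + integral {0..t} (\<lambda>s. f s (flow p s) j)"
    by (subst (asm) Henstock_Kurzweil_Integration.integral_diff)
       (auto intro!: integrable_continuous_interval continuous_on_subset[OF f_picard_cont] continuous_on_subset[OF fc])
qed

lemma flow_init: "flow p 0 j = p j"
  using flow_integral[of 0 p j] by simp

lemma flow_der:
  assumes t: "0 \<le> t"
  shows "((\<lambda>s. flow p s j) has_real_derivative f t (flow p t) j) (at t within {0..})"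
proof -
  have fc: "continuous_on {0..} (\<lambda>s. f s (flow p s) j)" by (rule cont[OF flow_cont])
  have "((\<lambda>s. p j + integral {0..s} (\<lambda>s. f s (flow p s) j)) has_real_derivative f t (flow p t) j) (at t within {0..})"
    using DERIV_add[OF DERIV_const[of "p j"] integral_has_real_derivative_Ici[OF fc t]] by simp
  then show ?thesis
    by (rule has_field_derivative_transform_within[where d = 1]) (use t flow_integral in auto)
qed

text \<open>In the weighted norm an error E becomes at most B + E / 2 in one step, and E = 2 B is
  preserved.\<close>

lemma picard_dependence:
  assumes pq: "\<And>i. \<bar>p i - q i\<bar> \<le> B"
  shows "0 \<le> t \<Longrightarrow> \<bar>picard m p t j - picard m q t j\<bar> \<le> 2 * B * exp (2*K*t)"
proof (induction m arbitrary: t j)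
  case 0
  have "B \<ge> 0" using pq[of 0] by linarith
  then have "B * 1 \<le> B * exp (2*K*t)" using 0 K by (intro mult_left_mono) auto
  then show ?case using pq[of j] \<open>0 \<le> B\<close> by simp
next
  case (Suc m)
  have B: "B \<ge> 0" using pq[of 0] by linarith
  have "\<bar>integral {0..t} (\<lambda>s. f s (picard m p s) j - f s (picard m q s) j)\<bar>
      \<le> (2 * B) / 2 * (exp (2 * K * t) - 1)"
  proof (rule abs_integral_le_exp[OF _ Suc.prems K])
    show "continuous_on {0..} (\<lambda>s. f s (picard m p s) j - f s (picard m q s) j)"
      by (intro continuous_intros f_picard_cont)
    fix s :: real assume s: "0 \<le> s"
    show "\<bar>f s (picard m p s) j - f s (picard m q s) j\<bar> \<le> K * (2 * B) * exp (2 * K * s)"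
      using lip[of s "picard m p s" "picard m q s", OF s Suc.IH[OF s]] by (simp only: mult.assoc)
  qed
  also have "integral {0..t} (\<lambda>s. f s (picard m p s) j - f s (picard m q s) j)
     = (picard (Suc m) p t j - picard (Suc m) q t j) - (p j - q j)"
    unfolding picard.simps(2)
    by (subst Henstock_Kurzweil_Integration.integral_diff)
       (auto intro!: integrable_continuous_interval continuous_on_subset[OF f_picard_cont] simp del: picard.simps)
  finally have "\<bar>picard (Suc m) p t j - picard (Suc m) q t j\<bar> \<le> B + B * (exp (2 * K * t) - 1)"
    using pq[of j] by (simp del: picard.simps)
  then show ?case using B mult_nonneg_nonneg[of B "exp (2*K*t)"] by (simp add: algebra_simps del: picard.simps)
qed

lemma flow_dependence:
  assumes pq: "\<And>i. \<bar>p i - q i\<bar> \<le> B" and t: "0 \<le> t"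
  shows "\<bar>flow p t j - flow q t j\<bar> \<le> 2 * B * exp (2*K*t)"
proof (rule LIMSEQ_le_const2)
  show "(\<lambda>m. \<bar>picard m p t j - picard m q t j\<bar>) \<longlonglongrightarrow> \<bar>flow p t j - flow q t j\<bar>"
    by (intro tendsto_intros picard_tendsto t)
  show "\<exists>N. \<forall>n\<ge>N. \<bar>picard n p t j - picard n q t j\<bar> \<le> 2 * B * exp (2*K*t)"
    by (intro exI[of _ 0] allI impI picard_dependence[OF pq t])
qed

end

section \<open>The clipped truncated system\<close>

text \<open>\<open>eta\<close>, \<open>Dc\<close> and \<open>nu\<close> are the conditions of a pair
  written in the parameters of the system: forcing accumulated during the killing phase, total drain
  compared with the initial size of the killer, and completion of the killing of mode 0 well before
  time 1/4.\<close>

locale shell =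
  fixes \<nu> \<epsilon> L :: real
  assumes eps: "0 < \<epsilon>" "\<epsilon> \<le> 1/100"
    and L: "5/2 * ln (1/\<epsilon>) + 300 \<le> L"
    and eta: "(1 + 2/\<epsilon>) / \<nu> * L \<le> 1/1000"
    and Dc: "18 * \<epsilon>^3 * exp (L/2) / \<nu> \<le> \<epsilon> / 10"
    and nu: "4 * (L + 9) \<le> \<nu>"
begin

definition rhs :: "(nat \<Rightarrow> real) \<Rightarrow> nat \<Rightarrow> real" where
  "rhs Z j = \<nu>^j * (((case j of 0 \<Rightarrow> 0 | Suc i \<Rightarrow> Z i) - 1) * Z j - \<nu> * \<epsilon>\<^sup>2 * (Z (Suc j))\<^sup>2)"

text \<open>Modes at even distance from the top mode \<open>m\<close> are active, the other ones are to be killed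
  (dead); the mode \<open>j\<close> is killed by \<open>j + 1\<close>, whose time scale is \<open>1 / \<nu> ^ (j + 1)\<close>.\<close>

definition clip :: "nat \<Rightarrow> real \<Rightarrow> (nat \<Rightarrow> real) \<Rightarrow> nat \<Rightarrow> real" where
  "clip m t X j = (if m < j then 0
     else if even (m - j) then max (- (2/\<epsilon>)) (min (2/\<epsilon>) (X j))
     else max 0 (min (env L (\<nu>^(j+1) * t)) (X j)))"

definition clipped_rhs :: "nat \<Rightarrow> real \<Rightarrow> (nat \<Rightarrow> real) \<Rightarrow> nat \<Rightarrow> real" where
  "clipped_rhs m t X j = rhs (clip m t X) j"

definition Klip :: "nat \<Rightarrow> real" where
  "Klip m = \<nu>^m * (1 + 2 * (2/\<epsilon>) + \<nu> * \<epsilon>\<^sup>2 * (2 * (2/\<epsilon>)))"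
definition Mbd :: "nat \<Rightarrow> real" where
  "Mbd j = \<nu>^j * ((1 + 2/\<epsilon>) * (2/\<epsilon>) + \<nu> * \<epsilon>\<^sup>2 * (2/\<epsilon>)\<^sup>2)"

lemma eps_pos [simp]: "0 < \<epsilon>" "0 \<le> \<epsilon>" "\<epsilon> \<noteq> 0" using eps by auto
lemma L300: "300 \<le> L"
proof -
  have "0 \<le> ln (1/\<epsilon>)" using eps by (intro ln_ge_zero) simp
  thus ?thesis using L by linarith
qed
lemma nu1: "1200 \<le> \<nu>" using nu L300 by simp
lemma nu_pos [simp]: "0 < \<nu>" "0 \<le> \<nu>" "\<nu> \<noteq> 0" using nu1 by auto
lemma R3: "3 \<le> 2/\<epsilon>" using eps by (simp add: field_simps)

lemma clip_bound: "\<bar>clip m t X j\<bar> \<le> 2/\<epsilon>"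
  using env_le_3[of L "\<nu>^(j+1) * t"] R3 eps by (auto simp: clip_def abs_le_iff max_def min_def)

lemma clip_lip: "\<bar>X j - Y j\<bar> \<le> B \<Longrightarrow> \<bar>clip m t X j - clip m t Y j\<bar> \<le> B"
  by (auto simp: clip_def)

lemma clip_cont:
  assumes "\<And>i. continuous_on {0..} (\<lambda>t. X t i)"
  shows "continuous_on {0..} (\<lambda>t. clip m t (X t) j)"
  using assms by (cases "m < j"; cases "even (m - j)") (auto simp: clip_def intro!: continuous_intros)

lemma clip_zero: "m < j \<Longrightarrow> clip m t X j = 0" by (simp add: clip_def)

lemma abs_mult_le: "\<bar>a\<bar> \<le> A \<Longrightarrow> \<bar>b\<bar> \<le> (B::real) \<Longrightarrow> \<bar>a * b\<bar> \<le> A * B"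
  unfolding abs_mult by (intro mult_mono) auto

lemma prod_diff_le:
  fixes a b a' b' :: real
  assumes "\<bar>a\<bar> \<le> R" "\<bar>b'\<bar> \<le> S" "\<bar>a - a'\<bar> \<le> B" "\<bar>b - b'\<bar> \<le> B"
  shows "\<bar>a * b - a' * b'\<bar> \<le> (R + S) * B"
proof -
  have "a * b - a' * b' = a * (b - b') + (a - a') * b'" by (simp add: algebra_simps)
  also have "\<bar>\<dots>\<bar> \<le> R * B + B * S"
    using abs_mult_le[OF assms(1,4)] abs_mult_le[OF assms(3,2)] by linarith
  finally show ?thesis by (simp add: algebra_simps)
qed

lemma rhs_lip:
  assumes Z: "\<And>i. \<bar>Z i\<bar> \<le> 2/\<epsilon>" and W: "\<And>i. \<bar>W i\<bar> \<le> 2/\<epsilon>" and B: "\<And>i. \<bar>Z i - W i\<bar> \<le> B"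
  shows "\<bar>rhs Z j - rhs W j\<bar> \<le> \<nu>^j * (1 + 2 * (2/\<epsilon>) + \<nu> * \<epsilon>\<^sup>2 * (2 * (2/\<epsilon>))) * B"
proof -
  define a where "a = (case j of 0 \<Rightarrow> 0 | Suc i \<Rightarrow> Z i) - 1"
  define a' where "a' = (case j of 0 \<Rightarrow> 0 | Suc i \<Rightarrow> W i) - 1"
  have "0 \<le> B" using B[of 0] by linarith
  have aa: "\<bar>a\<bar> \<le> 2/\<epsilon> + 1" "\<bar>a - a'\<bar> \<le> B"
    using Z[of "j - 1"] B[of "j - 1"] \<open>0 \<le> B\<close> R3 by (auto simp: a_def a'_def split: nat.split)
  have 1: "\<bar>a * Z j - a' * W j\<bar> \<le> (2/\<epsilon> + 1 + 2/\<epsilon>) * B"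
    by (rule prod_diff_le[OF aa(1) W aa(2) B])
  have "\<bar>Z (Suc j) * Z (Suc j) - W (Suc j) * W (Suc j)\<bar> \<le> (2/\<epsilon> + 2/\<epsilon>) * B"
    by (rule prod_diff_le[OF Z W B B])
  then have 2: "\<bar>(\<nu> * \<epsilon>\<^sup>2) * ((Z (Suc j))\<^sup>2 - (W (Suc j))\<^sup>2)\<bar> \<le> (\<nu> * \<epsilon>\<^sup>2) * ((2/\<epsilon> + 2/\<epsilon>) * B)"
    by (intro abs_mult_le) (auto simp: power2_eq_square)
  have "rhs Z j - rhs W j = \<nu>^j * ((a * Z j - a' * W j) - (\<nu> * \<epsilon>\<^sup>2) * ((Z (Suc j))\<^sup>2 - (W (Suc j))\<^sup>2))"
    by (simp add: rhs_def a_def a'_def algebra_simps)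
  also have "\<bar>\<dots>\<bar> \<le> \<nu>^j * ((2/\<epsilon> + 1 + 2/\<epsilon>) * B + (\<nu> * \<epsilon>\<^sup>2) * ((2/\<epsilon> + 2/\<epsilon>) * B))"
    using 1 2 by (intro abs_mult_le) auto
  also have "\<dots> = \<nu>^j * (1 + 2 * (2/\<epsilon>) + \<nu> * \<epsilon>\<^sup>2 * (2 * (2/\<epsilon>))) * B"
    by (simp add: algebra_simps)
  finally show ?thesis .
qed

text \<open>The bound depends on the mode \<open>j\<close> but not on the truncation; this later
  yields equicontinuity.\<close>

lemma rhs_bound:
  assumes Z: "\<And>i. \<bar>Z i\<bar> \<le> 2/\<epsilon>"
  shows "\<bar>rhs Z j\<bar> \<le> Mbd j"
proof -
  define a where "a = (case j of 0 \<Rightarrow> 0 | Suc i \<Rightarrow> Z i) - 1"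
  have aa: "\<bar>a\<bar> \<le> 1 + 2/\<epsilon>" using Z[of "j - 1"] R3 by (auto simp: a_def split: nat.split)
  have 1: "\<bar>a * Z j\<bar> \<le> (1 + 2/\<epsilon>) * (2/\<epsilon>)" by (rule abs_mult_le[OF aa Z])
  have "\<bar>Z (Suc j)\<bar>\<^sup>2 \<le> (2/\<epsilon>)\<^sup>2" using Z by (intro power_mono) auto
  then have 2: "\<bar>(\<nu> * \<epsilon>\<^sup>2) * (Z (Suc j))\<^sup>2\<bar> \<le> (\<nu> * \<epsilon>\<^sup>2) * (2/\<epsilon>)\<^sup>2"
    by (intro abs_mult_le) auto
  have "rhs Z j = \<nu>^j * (a * Z j - (\<nu> * \<epsilon>\<^sup>2) * (Z (Suc j))\<^sup>2)"
    by (simp add: rhs_def a_def algebra_simps)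
  also have "\<bar>\<dots>\<bar> \<le> \<nu>^j * ((1 + 2/\<epsilon>) * (2/\<epsilon>) + \<nu> * \<epsilon>\<^sup>2 * (2/\<epsilon>)\<^sup>2)"
  proof (intro abs_mult_le)
    show "\<bar>a * Z j - (\<nu> * \<epsilon>\<^sup>2) * (Z (Suc j))\<^sup>2\<bar> \<le> (1 + 2/\<epsilon>) * (2/\<epsilon>) + \<nu> * \<epsilon>\<^sup>2 * (2/\<epsilon>)\<^sup>2"
      using 1 2 by linarith
  qed simp
  finally show ?thesis by (simp add: Mbd_def)
qed

lemma Mbd_mono: "i \<le> j \<Longrightarrow> Mbd i \<le> Mbd j"
  unfolding Mbd_def using nu1 R3 by (intro mult_right_mono power_increasing) auto

lemma clipped_rhs_beyond: "m < j \<Longrightarrow> clipped_rhs m t X j = 0"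
  by (simp add: clipped_rhs_def rhs_def clip_zero)

lemma Klip_pos: "0 < Klip m"
  unfolding Klip_def using R3 by (intro mult_pos_pos add_pos_nonneg) auto

lemma ode: "bounded_lipschitz_ode (clipped_rhs m) (Klip m) (Mbd m)"
proof
  show "0 < Klip m" by (rule Klip_pos)
  fix t :: real and X Y :: "nat \<Rightarrow> real" and B :: real and j :: nat
  assume B: "\<And>i. \<bar>X i - Y i\<bar> \<le> B"
  have B0: "0 \<le> B" using B[of 0] by linarith
  show "\<bar>clipped_rhs m t X j - clipped_rhs m t Y j\<bar> \<le> Klip m * B"
  proof (cases "m < j")
    case True
    then show ?thesis using B0 Klip_pos[of m] by (simp add: clipped_rhs_beyond)
  next
    case False
    have "\<bar>clipped_rhs m t X j - clipped_rhs m t Y j\<bar> \<le> \<nu>^j * (1 + 2 * (2/\<epsilon>) + \<nu> * \<epsilon>\<^sup>2 * (2 * (2/\<epsilon>))) * B"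
      unfolding clipped_rhs_def by (intro rhs_lip clip_bound clip_lip B)
    also have "\<dots> \<le> Klip m * B" unfolding Klip_def
      using False nu1 R3 B0 by (intro mult_right_mono power_increasing) auto
    finally show ?thesis .
  qed
next
  fix X :: "real \<Rightarrow> nat \<Rightarrow> real" and j :: nat
  assume X: "\<And>i. continuous_on {0..} (\<lambda>t. X t i)"
  have c: "continuous_on {0..} (\<lambda>t. clip m t (X t) i)" for i by (rule clip_cont) (rule X)
  show "continuous_on {0..} (\<lambda>t. clipped_rhs m t (X t) j)"
    unfolding clipped_rhs_def rhs_def by (cases j) (auto intro!: continuous_intros c)
next
  fix t :: real and X :: "nat \<Rightarrow> real" and j :: nat
  show "\<bar>clipped_rhs m t X j\<bar> \<le> Mbd m"
  proof (cases "m < j")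
    case True
    have "0 \<le> Mbd m" using rhs_bound[of "\<lambda>_. 0" m] R3 by fastforce
    with True show ?thesis by (simp add: clipped_rhs_beyond)
  next
    case False
    then show ?thesis using rhs_bound[of "clip m t X" j, OF clip_bound] Mbd_mono[of j m] by (simp add: clipped_rhs_def)
  qed
qed

section \<open>Flow of the clipped system and its pairs of modes\<close>

definition sol :: "nat \<Rightarrow> (nat \<Rightarrow> real) \<Rightarrow> real \<Rightarrow> nat \<Rightarrow> real" where
  "sol m = bounded_lipschitz_ode.flow (clipped_rhs m)"

lemmas sol_init = bounded_lipschitz_ode.flow_init[OF ode, folded sol_def]
lemmas sol_der = bounded_lipschitz_ode.flow_der[OF ode, folded sol_def]
lemmas sol_cont = bounded_lipschitz_ode.flow_cont[OF ode, folded sol_def]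
lemmas sol_dependence = bounded_lipschitz_ode.flow_dependence[OF ode, folded sol_def]

lemma sol_der_at:
  assumes "0 < t" shows "((\<lambda>s. sol m p s j) has_real_derivative clipped_rhs m t (sol m p t) j) (at t)"
proof -
  have "at t within {0..} = at t" using assms by (intro at_within_interior) (auto simp: interior_real_atLeast)
  then show ?thesis using sol_der[of t m p j] assms by simp
qed

definition data_box :: "(nat \<Rightarrow> real) set" where "data_box = {p. \<forall>i. 3/2 \<le> p i \<and> p i \<le> 5/2}"

text \<open>In the time of the killer, X_j has the slow rate 1 / nu, which makes its forcing small.
  X_(j+2) is either beyond the top mode or a killed mode under its own envelope, whose time runs
  nu^2 times faster; \<open>env_sq_le\<close> then gives the drain the rate \<gamma> = nu^2 /
  2.\<close>

lemma block_sol: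
  assumes p: "p \<in> data_box" and j: "j < m" "odd (m - j)" and T: "1 \<le> T"
  shows "block (\<lambda>\<tau>. sol m p (\<tau> / \<nu>^(j+1)) j) (\<lambda>\<tau>. \<epsilon> * sol m p (\<tau> / \<nu>^(j+1)) (j+1))
    (\<lambda>\<tau>. ((case j of 0 \<Rightarrow> 0 | Suc i \<Rightarrow> clip m (\<tau> / \<nu>^(j+1)) (sol m p (\<tau> / \<nu>^(j+1))) i) - 1) / \<nu>)
    (\<lambda>\<tau>. \<nu> * \<epsilon>^3 * (clip m (\<tau> / \<nu>^(j+1)) (sol m p (\<tau> / \<nu>^(j+1))) (j+2))\<^sup>2)
    ((1 + 2/\<epsilon>) / \<nu>) (\<nu>\<^sup>2 / 2) (18 * \<epsilon>^3 * exp (L/2) / \<nu>) \<epsilon> L (\<nu>^(j+1) * T)"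
proof
  define k where "k = j + 1"
  have k: "k \<le> m" "even (m - k)" using j by (auto simp: k_def)
  have nk: "0 < \<nu>^k" by simp
  have cs: "continuous_on {0..\<nu>^k * T} (\<lambda>\<tau>. sol m p (\<tau> / \<nu>^k) i)" for i
    by (rule continuous_on_compose2[OF sol_cont[of m p i], of _ "\<lambda>\<tau>. \<tau> / \<nu>^k"]) (auto intro!: continuous_intros)
  show "continuous_on {0..\<nu>^(j+1) * T} (\<lambda>\<tau>. sol m p (\<tau> / \<nu>^(j+1)) j)"
    using cs[of j] by (simp add: k_def)
  show "continuous_on {0..\<nu>^(j+1) * T} (\<lambda>\<tau>. \<epsilon> * sol m p (\<tau> / \<nu>^(j+1)) (j+1))"
    using cs[of k] by (auto intro!: continuous_intros simp: k_def)
  have cj: "clip m (\<tau> / \<nu>^k) X j = max 0 (min (env L \<tau>) (X j))" for \<tau> X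
    using j by (simp add: clip_def k_def)
  have ck: "\<epsilon> * clip m (\<tau> / \<nu>^k) X k = max (-2) (min 2 (\<epsilon> * X k))" for \<tau> X
    using k eps by (auto simp: clip_def max_def min_def field_simps)
  fix \<tau> assume \<tau>: "0 < \<tau>" "\<tau> < \<nu>^(j+1) * T"
  define t where "t = \<tau> / \<nu>^k"
  have nk': "\<nu>^k = \<nu> * \<nu>^j" "Suc j = k" and kj: "k = Suc j" "j + 2 = Suc (Suc j)" by (auto simp: k_def)
  have der: "((\<lambda>\<tau>. sol m p (\<tau> / \<nu>^k) i) has_real_derivative clipped_rhs m (\<tau> / \<nu>^k) (sol m p (\<tau> / \<nu>^k)) i * (1 / \<nu>^k)) (at \<tau>)" for i
    by (rule DERIV_chain2[OF sol_der_at DERIV_cdivide[OF DERIV_ident]]) (use \<tau> in simp)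
  have "((\<lambda>\<tau>. sol m p (\<tau> / \<nu>^k) j) has_real_derivative
     ((case j of 0 \<Rightarrow> 0 | Suc i \<Rightarrow> clip m (\<tau> / \<nu>^k) (sol m p (\<tau> / \<nu>^k)) i) - 1) / \<nu> *
     clip m (\<tau> / \<nu>^k) (sol m p (\<tau> / \<nu>^k)) j - (\<epsilon> * clip m (\<tau> / \<nu>^k) (sol m p (\<tau> / \<nu>^k)) k)\<^sup>2) (at \<tau>)"
    using der[of j] unfolding t_def[symmetric]
    by (rule DERIV_cong) (simp add: clipped_rhs_def rhs_def nk' field_simps power2_eq_square)
  then show "((\<lambda>\<tau>. sol m p (\<tau> / \<nu>^(j+1)) j) has_real_derivative
     ((case j of 0 \<Rightarrow> 0 | Suc i \<Rightarrow> clip m (\<tau> / \<nu>^(j+1)) (sol m p (\<tau> / \<nu>^(j+1))) i) - 1) / \<nu> *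
     max 0 (min (env L \<tau>) (sol m p (\<tau> / \<nu>^(j+1)) j)) - (max (-2) (min 2 (\<epsilon> * sol m p (\<tau> / \<nu>^(j+1)) (j+1))))\<^sup>2) (at \<tau>)"
    unfolding cj ck unfolding k_def .
  have "((\<lambda>\<tau>. \<epsilon> * sol m p (\<tau> / \<nu>^k) k) has_real_derivative
     (clip m (\<tau> / \<nu>^k) (sol m p (\<tau> / \<nu>^k)) j - 1) * (\<epsilon> * clip m (\<tau> / \<nu>^k) (sol m p (\<tau> / \<nu>^k)) k)
      - \<nu> * \<epsilon>^3 * (clip m (\<tau> / \<nu>^k) (sol m p (\<tau> / \<nu>^k)) (j+2))\<^sup>2) (at \<tau>)"
    using DERIV_cmult[OF der[of k], of \<epsilon>]
    unfolding t_def[symmetric]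
    by (rule DERIV_cong) (simp add: clipped_rhs_def rhs_def kj field_simps power2_eq_square power3_eq_cube)
  then show "((\<lambda>\<tau>. \<epsilon> * sol m p (\<tau> / \<nu>^(j+1)) (j+1)) has_real_derivative
     (max 0 (min (env L \<tau>) (sol m p (\<tau> / \<nu>^(j+1)) j)) - 1) * max (-2) (min 2 (\<epsilon> * sol m p (\<tau> / \<nu>^(j+1)) (j+1)))
      - \<nu> * \<epsilon>^3 * (clip m (\<tau> / \<nu>^(j+1)) (sol m p (\<tau> / \<nu>^(j+1))) (j+2))\<^sup>2) (at \<tau>)"
    unfolding cj ck unfolding k_def .
  show "\<bar>((case j of 0 \<Rightarrow> 0 | Suc i \<Rightarrow> clip m (\<tau> / \<nu>^(j+1)) (sol m p (\<tau> / \<nu>^(j+1))) i) - 1) / \<nu>\<bar> \<le> (1 + 2/\<epsilon>) / \<nu>"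
  proof -
    have "\<bar>(case j of 0 \<Rightarrow> 0 | Suc i \<Rightarrow> clip m (\<tau> / \<nu>^(j+1)) (sol m p (\<tau> / \<nu>^(j+1))) i) - 1\<bar> \<le> 1 + 2/\<epsilon>"
      using clip_bound[of m "\<tau> / \<nu>^(j+1)" "sol m p (\<tau> / \<nu>^(j+1))" "j - 1"] R3 by (auto split: nat.split)
    then show ?thesis by (simp add: divide_right_mono del: power_Suc)
  qed
  have "(clip m (\<tau> / \<nu>^k) (sol m p (\<tau> / \<nu>^k)) (j+2))\<^sup>2 \<le> (env L (\<nu>\<^sup>2 * \<tau>))\<^sup>2"
  proof (cases "m < j + 2")
    case False
    then have "odd (m - (j+2))" using j by presburger
    moreover have "\<nu>^(j+2+1) * (\<tau> / \<nu>^k) = \<nu>\<^sup>2 * \<tau>" by (simp add: k_def power2_eq_square)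
    ultimately show ?thesis using False by (intro power_mono) (auto simp: clip_def)
  qed (simp add: clip_def)
  also have "\<dots> \<le> 9 * exp (L/2) * exp (- (\<nu>\<^sup>2 * \<tau>) / 2)" by (rule env_sq_le)
  finally have "\<nu> * \<epsilon>^3 * (clip m (\<tau> / \<nu>^k) (sol m p (\<tau> / \<nu>^k)) (j+2))\<^sup>2
      \<le> \<nu> * \<epsilon>^3 * (9 * exp (L/2) * exp (- (\<nu>\<^sup>2 * \<tau>) / 2))"
    using eps by (intro mult_left_mono) auto
  also have "\<dots> = 18 * \<epsilon>^3 * exp (L/2) / \<nu> * (\<nu>\<^sup>2 / 2) * exp (- (\<nu>\<^sup>2 / 2) * \<tau>)"
    by (simp add: field_simps power2_eq_square)
  finally show "0 \<le> \<nu> * \<epsilon>^3 * (clip m (\<tau> / \<nu>^(j+1)) (sol m p (\<tau> / \<nu>^(j+1))) (j+2))\<^sup>2 \<and>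
     \<nu> * \<epsilon>^3 * (clip m (\<tau> / \<nu>^(j+1)) (sol m p (\<tau> / \<nu>^(j+1))) (j+2))\<^sup>2
     \<le> 18 * \<epsilon>^3 * exp (L/2) / \<nu> * (\<nu>\<^sup>2 / 2) * exp (- (\<nu>\<^sup>2 / 2) * \<tau>)"
    using eps by (simp add: k_def)
next
  have pj: "3/2 \<le> p i" "p i \<le> 5/2" for i using p by (auto simp: data_box_def)
  show "3/2 \<le> sol m p (0 / \<nu>^(j+1)) j" "sol m p (0 / \<nu>^(j+1)) j \<le> 5/2"
    using pj[of j] by (auto simp: sol_init)
  show "3/2 * \<epsilon> \<le> \<epsilon> * sol m p (0 / \<nu>^(j+1)) (j+1)" "\<epsilon> * sol m p (0 / \<nu>^(j+1)) (j+1) \<le> 5/2 * \<epsilon>"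
    using pj[of "j+1"] eps by (auto simp: sol_init)
  show "0 \<le> (1 + 2/\<epsilon>) / \<nu>" using R3 by simp
  show "0 \<le> 18 * \<epsilon>^3 * exp (L/2) / \<nu>" using eps by simp
  have "1 * 1200 \<le> \<nu>\<^sup>2" unfolding power2_eq_square using nu1 by (intro mult_mono) auto
  then show "1 \<le> \<nu>\<^sup>2 / 2" by simp
  have "\<nu>^1 * 1 \<le> \<nu>^(j+1) * T" using nu1 T by (intro mult_mono power_increasing) auto
  moreover have "L + 8 \<le> \<nu>" using nu L300 by simp
  ultimately show "L + 8 \<le> \<nu>^(j+1) * T" unfolding power_one_right mult_1_right by (rule order_trans[rotated])
qed (rule eps L eta Dc)+

text \<open>Together with \<open>dead_high\<close> these are the face conditions for Kuhn's lemma: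
  they hold for all values in \<open>data_box\<close> of the other components.\<close>

lemma dead_low:
  assumes "p \<in> data_box" "j < m" "odd (m - j)" "1 \<le> T" "p j = 3/2"
  shows "env L (\<nu>^(j+1) * T) \<le> sol m p T j"
  using block.low_start[OF block_sol[OF assms(1-4)]] assms(5) by (simp add: sol_init)

lemma dead_high:
  assumes "p \<in> data_box" "j < m" "odd (m - j)" "1 \<le> T" "p j = 5/2"
  shows "sol m p T j \<le> 0"
  using block.high_start[OF block_sol[OF assms(1-4)]] assms(5) by (simp add: sol_init)

lemma dead_survivor:
  assumes "p \<in> data_box" "j < m" "odd (m - j)" "1 \<le> T"
    and "0 < sol m p T j" "sol m p T j < env L (\<nu>^(j+1) * T)" and t: "0 \<le> t" "t \<le> T"
  shows "0 \<le> sol m p t j" "sol m p t j \<le> env L (\<nu>^(j+1) * t)"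
proof -
  have "\<nu>^(j+1) * t \<le> \<nu>^(j+1) * T" using t by (intro mult_left_mono) auto
  then show "0 \<le> sol m p t j" "sol m p t j \<le> env L (\<nu>^(j+1) * t)"
    using block.survivor[OF block_sol[OF assms(1-4)], of "\<nu>^(j+1) * t"] assms(5-) by auto
qed

lemma active_bound:
  assumes "p \<in> data_box" "j + 1 \<le> m" "even (m - (j + 1))" "1 \<le> T" and t: "0 \<le> t" "t \<le> T"
  shows "\<bar>sol m p t (j+1)\<bar> \<le> 2/\<epsilon>"
proof -
  have j: "j < m" "odd (m - j)" using assms by auto
  have "\<nu>^(j+1) * t \<le> \<nu>^(j+1) * T" using t by (intro mult_left_mono) auto
  then have "\<bar>\<epsilon> * sol m p t (j+1)\<bar> \<le> 2"
    using block.y_le_2[OF block_sol[OF assms(1) j assms(4)], of "\<nu>^(j+1) * t"] t by auto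
  then show ?thesis using eps by (simp add: abs_mult field_simps)
qed

text \<open>The lowest active mode has no dead partner below it.\<close>

lemma active_zero:
  assumes p: "p \<in> data_box" and m: "even m" and t: "0 \<le> t"
  shows "\<bar>sol m p t 0\<bar> \<le> 2/\<epsilon>" "7/5 - 5/2 * t \<le> sol m p t 0"
proof -
  define y where "y = (\<lambda>t. sol m p t 0)"
  define c where "c t = clip m t (sol m p t) 0" for t
  \<comment> \<open>Bound for the total loss of mode 0 to the killed mode 1; as for a pair, it is
    absorbed into the corrected function \<open>yt\<close>.\<close>
  define H where "H = 18 * \<epsilon>\<^sup>2 * exp (L/2) / \<nu>"
  define yt where "yt t = y t - H * exp (- (\<nu>\<^sup>2/2) * t)" for t
  have "\<epsilon> * H \<le> \<epsilon> * (1/10)" using Dc by (simp add: H_def power3_eq_cube power2_eq_square mult_ac)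
  then have "H \<le> 1/10" by (simp only: mult_le_cancel_left_pos eps_pos)
  then have H: "0 \<le> H" "H \<le> 1/10" by (auto simp: H_def)
  have c: "c t = max (- (2/\<epsilon>)) (min (2/\<epsilon>) (y t))" for t using m by (simp add: c_def clip_def y_def)
  have yd: "(y has_real_derivative - c t - \<nu> * \<epsilon>\<^sup>2 * (clip m t (sol m p t) 1)\<^sup>2) (at t)" if "0 < t" for t
    unfolding y_def using sol_der_at[OF that, of m p 0] by (simp add: clipped_rhs_def rhs_def c_def)
  have ytd: "\<exists>D. (yt has_real_derivative D) (at t) \<and> - c t \<le> D" if "0 < t" for t
  proof -
    have "(clip m t (sol m p t) 1)\<^sup>2 \<le> (env L (\<nu>\<^sup>2 * t))\<^sup>2"
      using m by (intro power_mono) (auto simp: clip_def power2_eq_square)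
    also have "\<dots> \<le> 9 * exp (L/2) * exp (- (\<nu>\<^sup>2 * t) / 2)" by (rule env_sq_le)
    finally have "\<nu> * \<epsilon>\<^sup>2 * (clip m t (sol m p t) 1)\<^sup>2 \<le> \<nu> * \<epsilon>\<^sup>2 * (9 * exp (L/2) * exp (- (\<nu>\<^sup>2 * t) / 2))"
      by (intro mult_left_mono) auto
    also have "\<dots> = H * (\<nu>\<^sup>2/2) * exp (- (\<nu>\<^sup>2/2) * t)"
      by (simp add: H_def field_simps power2_eq_square)
    finally have "- c t \<le> - c t - \<nu> * \<epsilon>\<^sup>2 * (clip m t (sol m p t) 1)\<^sup>2 - H * (exp (- (\<nu>\<^sup>2/2) * t) * (- (\<nu>\<^sup>2/2)))"
      by (simp add: mult_ac)
    moreover have "(yt has_real_derivative (- c t - \<nu> * \<epsilon>\<^sup>2 * (clip m t (sol m p t) 1)\<^sup>2 - H * (exp (- (\<nu>\<^sup>2/2) * t) * (- (\<nu>\<^sup>2/2))))) (at t)"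
      unfolding yt_def by (rule derivative_eq_intros yd[OF that] refl | simp)+
    ultimately show ?thesis by blast
  qed
  have cy: "continuous_on {0..t} y" unfolding y_def by (rule continuous_on_subset[OF sol_cont]) auto
  have cyt: "continuous_on {0..t} yt" unfolding yt_def by (intro continuous_intros cy)
  have yty: "yt s \<le> y s" "y s \<le> yt s + 1/10" if "0 \<le> s" for s
  proof -
    have "H * exp (- (\<nu>\<^sup>2/2) * s) \<le> H * 1" using H that by (intro mult_left_mono) auto
    then show "yt s \<le> y s" "y s \<le> yt s + 1/10" using H by (auto simp: yt_def)
  qed
  have p0: "3/2 \<le> p 0" "p 0 \<le> 5/2" using p by (auto simp: data_box_def)
  have up: "y s \<le> 5/2" if "0 \<le> s" "s \<le> t" for s
  proof -
    have "y s - 5/2 \<le> 0"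
    proof (rule barrier[where f = "\<lambda>s. y s - 5/2" and s = 0 and C = 0 and \<kappa> = 1])
      show "continuous_on {0..s} (\<lambda>s. y s - 5/2)"
        by (intro continuous_intros continuous_on_subset[OF cy]) (use that in auto)
      fix r assume r: "0 < r" "0 < y r - 5/2"
      have "0 \<le> \<nu> * \<epsilon>\<^sup>2 * (clip m r (sol m p r) 1)\<^sup>2" by simp
      then have le: "- c r - \<nu> * \<epsilon>\<^sup>2 * (clip m r (sol m p r) 1)\<^sup>2 - 0 \<le> 0" using r R3 unfolding c by linarith
      from DERIV_diff[OF yd[OF r(1)] DERIV_const[of "5/2"]] le
      show "\<exists>D. ((\<lambda>s. y s - 5/2) has_real_derivative D) (at r) \<and> D \<le> 0 * (y r - 5/2)"
        by (intro exI conjI) (assumption, simp)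
    qed (use that p0 in \<open>auto simp: y_def sol_init\<close>)
    thus ?thesis by simp
  qed
  have "- (1/10) - yt t \<le> 0"
  proof (rule barrier[where f = "\<lambda>s. - (1/10) - yt s" and s = 0 and C = 0 and \<kappa> = 1])
    show "continuous_on {0..t} (\<lambda>s. - (1/10) - yt s)" by (intro continuous_intros cyt)
    show "- (1/10) - yt 0 \<le> 0" using p0 H by (simp add: yt_def y_def sol_init)
    fix r assume r: "0 < r" "0 < - (1/10) - yt r"
    obtain D where D: "(yt has_real_derivative D) (at r)" "- c r \<le> D" using ytd[OF r(1)] by auto
    have "y r \<le> 0" using yty[of r] r by linarith
    then have "0 - D \<le> 0" using D(2) R3 unfolding c by linarith
    with DERIV_diff[OF DERIV_const[of "- (1/10)"] D(1)]
    show "\<exists>D. ((\<lambda>s. - (1/10) - yt s) has_real_derivative D) (at r) \<and> D \<le> 0 * (- (1/10) - yt r)"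
      by (intro exI conjI) (assumption, simp)
  qed (use t in auto)
  then show "\<bar>sol m p t 0\<bar> \<le> 2/\<epsilon>"
    using yty[of t] up[of t] t R3 unfolding y_def by linarith
  have "(7/5 - 5/2 * t) - yt t \<le> 0"
  proof (rule barrier[where f = "\<lambda>s. (7/5 - 5/2 * s) - yt s" and s = 0 and C = 0 and \<kappa> = 1])
    show "continuous_on {0..t} (\<lambda>s. (7/5 - 5/2 * s) - yt s)" by (intro continuous_intros cyt)
    show "(7/5 - 5/2 * 0) - yt 0 \<le> 0" using p0 H by (simp add: yt_def y_def sol_init)
    fix r assume r: "0 < r" "r < t"
    obtain D where D: "(yt has_real_derivative D) (at r)" "- c r \<le> D" using ytd[OF r(1)] by auto
    have "- (5/2) - D \<le> 0" using D(2) up[of r] r R3 unfolding c by linarith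
    moreover have "((\<lambda>s. (7/5 - 5/2 * s) - yt s) has_real_derivative - (5/2) - D) (at r)"
      by (rule derivative_eq_intros D(1) refl | simp)+
    ultimately show "\<exists>D. ((\<lambda>s. (7/5 - 5/2 * s) - yt s) has_real_derivative D) (at r) \<and> D \<le> 0 * ((7/5 - 5/2 * r) - yt r)"
      by (intro exI conjI) (assumption, simp)
  qed (use t in auto)
  then show "7/5 - 5/2 * t \<le> sol m p t 0" using yty[of t] t unfolding y_def by linarith
qed

end

section \<open>Shooting and passage to the limit\<close>

context shell
begin

section \<open>Choice of the initial values\<close>

definition top_mode :: "nat \<Rightarrow> nat \<Rightarrow> nat" where
  "top_mode n j = (if odd j then 2 * n else 2 * n - 1)"

lemma top_mode: "j < 2 * n \<Longrightarrow> j < top_mode n j \<and> odd (top_mode n j - j)"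
proof (cases "odd j")
  case True
  moreover assume "j < 2 * n"
  ultimately show ?thesis by (simp add: top_mode_def)
next
  case False
  moreover assume "j < 2 * n"
  ultimately have "j < 2 * n - 1" "odd (2 * n - 1 - j)" by presburger+
  then show ?thesis using False by (simp add: top_mode_def)
qed

lemma env_antimono: "s \<le> t \<Longrightarrow> env L t \<le> env L s"
  by (simp add: env_def)

text \<open>Simultaneous shooting in the \<open>2 n\<close> initial values: odd components are tuned for the system
  with top mode \<open>2 n\<close>, even ones for the system with top mode \<open>2 n - 1\<close>. A grid cube on which all
  labels change provides an approximate zero, which suffices.\<close>

lemma shooting:
  assumes T: "1 \<le> T"
  shows "\<exists>p\<in>data_box. \<forall>j<2*n. 0 < sol (top_mode n j) p T j \<and>
            sol (top_mode n j) p T j < env L (\<nu>^(j+1) * T)"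
proof -
  define N where "N = 2 * n"
  \<comment> \<open>The target is the open interval between 0 and the envelope; \<open>F\<close>
    measures the deviation from its midpoint.\<close>
  define F where "F p j = sol (top_mode n j) p T j - env L (\<nu>^(j+1) * T) / 2" for p j
  define K where "K = max (Klip (2*n)) (Klip (2*n - 1))"
  define C where "C = 2 * exp (2 * K * T)"
  \<comment> \<open>A quarter of an envelope value below those of all tuned modes at time
    \<open>T\<close>, so |F| < e puts each of them inside its interval.\<close>
  define e where "e = env L (\<nu>^N * T) / 4"
  have "0 < e" "0 < C" by (auto simp: e_def C_def)
  then obtain P :: nat where P: "C / e < real P" using reals_Archimedean2 by blast
  then have P0: "0 < P" using \<open>0 < e\<close> \<open>0 < C\<close> by (metis divide_pos_pos less_trans of_nat_0_less_iff)
  have small: "C * (1 / real P) < e" using P P0 \<open>0 < e\<close> by (simp add: field_simps)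
  \<comment> \<open>Grid points of the cube. The value 2 beyond the tuned components is just some
    point of \<open>data_box\<close>.\<close>
  define pt where "pt q i = (if i < N then 3/2 + real (q i) / real P else (2::real))" for q :: "nat \<Rightarrow> nat" and i
  define lab where "lab q i = (if 0 < F (pt q) i then 0 else 1::nat)" for q i
  have pt_data_box: "pt q \<in> data_box" if "\<forall>i<N. q i \<le> P" for q
    using that P0 by (auto simp: data_box_def pt_def field_simps)
  have dep: "\<bar>F p j - F q j\<bar> < e" if "\<And>i. \<bar>p i - q i\<bar> \<le> 1 / real P" for p q j
  proof -
    have "Klip (top_mode n j) \<le> K" by (auto simp: K_def top_mode_def)
    then have ex: "exp (2 * Klip (top_mode n j) * T) \<le> exp (2 * K * T)" using T by simp
    have "\<bar>F p j - F q j\<bar> \<le> 2 * (1 / real P) * exp (2 * Klip (top_mode n j) * T)"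
      unfolding F_def using sol_dependence[of p q "1 / real P" T "top_mode n j" j] that T by simp
    also have "\<dots> \<le> 2 * (1 / real P) * exp (2 * K * T)" using ex by (intro mult_left_mono) auto
    also have "\<dots> = C * (1 / real P)" by (simp add: C_def)
    finally show ?thesis using small by linarith
  qed
  obtain q where q: "\<forall>i<N. q i < P"
    and sw: "\<forall>i<N. \<exists>r s. (\<forall>j<N. q j \<le> r j \<and> r j \<le> q j + 1) \<and> (\<forall>j<N. q j \<le> s j \<and> s j \<le> q j + 1) \<and> lab r i \<noteq> lab s i"
  proof (rule kuhn_lemma[of P N lab])
    show "\<forall>x. (\<forall>i<N. x i \<le> P) \<longrightarrow> (\<forall>i<N. x i = 0 \<longrightarrow> lab x i = 0)"
    proof (intro allI impI)
      fix x i assume x: "\<forall>i<N. x i \<le> P" and i: "i < N" "x i = 0"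
      have "env L (\<nu>^(i+1) * T) \<le> sol (top_mode n i) (pt x) T i"
        using top_mode[of i n] i T by (intro dead_low pt_data_box x) (auto simp: N_def pt_def)
      then show "lab x i = 0" using env_pos[of L "\<nu>^(i+1) * T"] by (simp add: lab_def F_def del: env_pos)
    qed
    show "\<forall>x. (\<forall>i<N. x i \<le> P) \<longrightarrow> (\<forall>i<N. x i = P \<longrightarrow> lab x i = 1)"
    proof (intro allI impI)
      fix x i assume x: "\<forall>i<N. x i \<le> P" and i: "i < N" "x i = P"
      have "sol (top_mode n i) (pt x) T i \<le> 0"
        using top_mode[of i n] i T P0 by (intro dead_high pt_data_box x) (auto simp: N_def pt_def)
      then show "lab x i = 1" using env_pos[of L "\<nu>^(i+1) * T"] by (simp add: lab_def F_def del: env_pos)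
    qed
  qed (use P0 in \<open>auto simp: lab_def\<close>)
  show ?thesis
  proof (intro bexI[of _ "pt q"] allI impI)
    show "pt q \<in> data_box" using q by (intro pt_data_box) (auto simp: less_imp_le)
    fix j assume j: "j < 2 * n"
    then obtain r s where rs: "\<forall>j<N. q j \<le> r j \<and> r j \<le> q j + 1" "\<forall>j<N. q j \<le> s j \<and> s j \<le> q j + 1"
      "lab r j \<noteq> lab s j" using sw unfolding N_def by blast
    have near: "\<bar>pt q i - pt r i\<bar> \<le> 1 / real P" if "\<forall>j<N. q j \<le> r j \<and> r j \<le> q j + 1" for r i
    proof (cases "i < N")
      case True
      then have "real (q i) \<le> real (r i)" "real (r i) \<le> real (q i) + 1" using that by (auto simp flip: of_nat_Suc)
      then have "\<bar>(real (q i) - real (r i)) / real P\<bar> \<le> 1 / real P"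
        unfolding abs_divide by (intro divide_mono) (use P0 in auto)
      then show ?thesis using True by (simp add: pt_def diff_divide_distrib)
    qed (simp add: pt_def)
    \<comment> \<open>\<open>F\<close> has different labels at two points of the cell of
      \<open>q\<close> and varies by less than \<open>e\<close> from \<open>q\<close> to either, so
      it is within \<open>e\<close> of 0 at \<open>q\<close>.\<close>
    have "\<bar>F (pt q) j\<bar> < e"
      using dep[of "pt q" "pt r" j, OF near[OF rs(1)]] dep[of "pt q" "pt s" j, OF near[OF rs(2)]] rs(3)
      by (auto simp: lab_def split: if_splits)
    moreover have "e \<le> env L (\<nu>^(j+1) * T) / 4"
    proof -
      have "\<nu>^(j+1) * T \<le> \<nu>^N * T"
        using j nu1 T by (intro mult_right_mono power_increasing) (auto simp: N_def)
      from env_antimono[OF this] show ?thesis unfolding e_def by simp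
    qed
    ultimately show "0 < sol (top_mode n j) (pt q) T j \<and> sol (top_mode n j) (pt q) T j < env L (\<nu>^(j+1) * T)"
      unfolding F_def using env_pos[of L "\<nu>^(j+1) * T"] by (auto simp: abs_less_iff simp del: env_pos)
  qed
qed

section \<open>Trajectories of the unclipped system and their compactness\<close>

definition trajectory :: "real \<Rightarrow> (nat \<Rightarrow> bool) \<Rightarrow> (real \<Rightarrow> nat \<Rightarrow> real) \<Rightarrow> bool" where
  "trajectory T P u \<longleftrightarrow> (\<forall>t\<in>{0..T}. \<forall>j. \<bar>u t j\<bar> \<le> 2/\<epsilon> \<and>
     ((\<lambda>s. u s j) has_real_derivative rhs (u t) j) (at t within {0..T}) \<and>
     (P j \<longrightarrow> 0 \<le> u t j \<and> u t j \<le> env L (\<nu>^(j+1) * t)))"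

text \<open>Survival of the killed modes and the a priori bounds of the active ones make all clips
  inactive. Beyond the top mode every term of the right-hand side contains a vanishing mode, so the
  extension by 0 solves the full system exactly.\<close>

lemma trajectory_truncation:
  assumes p: "p \<in> data_box" and T: "1 \<le> T"
    and surv: "\<And>j. j < m \<Longrightarrow> odd (m - j) \<Longrightarrow> 0 < sol m p T j \<and> sol m p T j < env L (\<nu>^(j+1) * T)"
    and P: "\<And>j. j \<le> m \<Longrightarrow> P j \<Longrightarrow> odd (m - j)"
  shows "trajectory T P (\<lambda>t j. if j \<le> m then sol m p t j else 0)"
proof -
  define u where "u = (\<lambda>t j. if j \<le> m then sol m p t j else 0)"
  have u: "u t = clip m t (sol m p t)" if t: "0 \<le> t" "t \<le> T" for t
  proof
    fix j
    have "m < j \<or> (j \<le> m \<and> even (m - j)) \<or> (j < m \<and> odd (m - j))" by presburger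
    then consider "m < j" | "j \<le> m" "even (m - j)" | "j < m" "odd (m - j)" by blast
    then show "u t j = clip m t (sol m p t) j"
    proof cases
      case 2
      have "\<bar>sol m p t j\<bar> \<le> 2/\<epsilon>"
      proof (cases j)
        case 0
        then show ?thesis using active_zero(1)[OF p _ t(1), of m] 2 by simp
      next
        case (Suc i)
        then show ?thesis using active_bound[OF p _ _ T t, of i m] 2 by simp
      qed
      then have "max (- (2/\<epsilon>)) (min (2/\<epsilon>) (sol m p t j)) = sol m p t j" by auto
      then show ?thesis using 2 by (simp add: u_def clip_def)
    next
      case 3
      then show ?thesis using dead_survivor[OF p 3 T _ _ t] surv[OF 3] by (simp add: u_def clip_def)
    qed (auto simp: u_def clip_def)
  qed
  have "trajectory T P u" unfolding trajectory_def
  proof (intro ballI allI conjI impI)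
    fix t j assume "t \<in> {0..T}"
    then have t: "0 \<le> t" "t \<le> T" by auto
    show "\<bar>u t j\<bar> \<le> 2/\<epsilon>" unfolding u[OF t] by (rule clip_bound)
    show "((\<lambda>s. u s j) has_real_derivative rhs (u t) j) (at t within {0..T})"
    proof (cases "j \<le> m")
      case True
      have "((\<lambda>s. sol m p s j) has_real_derivative rhs (u t) j) (at t within {0..T})"
        using has_field_derivative_subset[OF sol_der[OF t(1), of m p j], of "{0..T}"] by (simp add: clipped_rhs_def u[OF t])
      then show ?thesis using True by (simp add: u_def)
    next
      case False
      then have "rhs (u t) j = 0" by (simp add: rhs_def u_def)
      then show ?thesis using False by (simp add: u_def)
    qed
    assume "P j"
    then consider "m < j" | "j \<le> m" "odd (m - j)" using P[of j] by linarith
    then show "0 \<le> u t j" "u t j \<le> env L (\<nu>^(j+1) * t)"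
      by (cases; auto simp: u[OF t] clip_def)+
  qed
  then show ?thesis by (simp add: u_def)
qed

lemma two_trajectories:
  assumes T: "1 \<le> T" and n: "1 \<le> n"
  shows "\<exists>a b p. p \<in> data_box \<and> trajectory T odd a \<and> trajectory T even b \<and>
    (\<forall>j<2 * n. a 0 j = p j \<and> b 0 j = p j) \<and> 7/10 \<le> a (1/4) 0"
proof -
  obtain p where p: "p \<in> data_box" and surv: "\<And>j. j < 2*n \<Longrightarrow> 0 < sol (top_mode n j) p T j \<and>
            sol (top_mode n j) p T j < env L (\<nu>^(j+1) * T)"
    using shooting[OF T, of n] by blast
  define u where "u m = (\<lambda>t j. if j \<le> m then sol m p t j else 0)" for m
  have a: "trajectory T odd (u (2*n))" unfolding u_def
  proof (rule trajectory_truncation[OF p T])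
    fix j assume "j < 2 * n" "odd (2 * n - j)"
    then have "odd j \<and> j < 2 * n" by presburger
    then show "0 < sol (2 * n) p T j \<and> sol (2 * n) p T j < env L (\<nu>^(j+1) * T)"
      using surv[of j] by (simp add: top_mode_def)
  qed auto
  obtain k where k: "n = Suc k" using n by (cases n) auto
  have b: "trajectory T even (u (2*n - 1))" unfolding u_def
  proof (rule trajectory_truncation[OF p T])
    fix j assume j: "j < 2 * n - 1" "odd (2 * n - 1 - j)"
    have "even j \<and> j < 2 * n" using j k by simp
    then show "0 < sol (2 * n - 1) p T j \<and> sol (2 * n - 1) p T j < env L (\<nu>^(j+1) * T)"
      using surv[of j] by (simp add: top_mode_def)
  next
    fix j assume "j \<le> 2 * n - 1" "even j"
    then show "odd (2 * n - 1 - j)" using k by simp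
  qed
  have "7/10 \<le> u (2*n) (1/4) 0" using active_zero(2)[OF p, of "2*n" "1/4"] by (simp add: u_def)
  then show ?thesis
    by (intro exI[of _ "u (2*n)"] exI[of _ "u (2*n-1)"] exI[of _ p] conjI p a b) (auto simp: u_def sol_init)
qed

text \<open>The constant depends neither on \<open>T\<close> nor on the truncation, which is the
  equicontinuity for the diagonal argument.\<close>

lemma trajectory_lipschitz:
  assumes "trajectory T P u" "s \<in> {0..T}" "t \<in> {0..T}"
  shows "\<bar>u s j - u t j\<bar> \<le> Mbd j * \<bar>s - t\<bar>"
proof -
  have "norm (u s j - u t j) \<le> Mbd j * norm (s - t)"
    using assms rhs_bound unfolding trajectory_def
    by (intro field_differentiable_bound[of "{0..T}" "\<lambda>t. u t j" "\<lambda>t. rhs (u t) j"]) auto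
  then show ?thesis by simp
qed

text \<open>Arzela-Ascoli: a diagonal sequence over all pairs of a mode and a rational time,
  extended to real times by equicontinuity.\<close>

lemma convergent_subsequence:
  fixes u :: "nat \<Rightarrow> real \<Rightarrow> nat \<Rightarrow> real"
  assumes tr: "\<And>n. trajectory (real n) P (u n)"
  obtains r where "strict_mono r" "\<And>j t. 0 \<le> t \<Longrightarrow> convergent (\<lambda>n. u (r n) t j)"
proof -
  define J where "J i = fst (from_nat i :: nat \<times> rat)" for i
  define Q where "Q i = \<bar>real_of_rat (snd (from_nat i :: nat \<times> rat))\<bar>" for i
  interpret subseqs "\<lambda>i s. convergent (\<lambda>n. u (s n) (Q i) (J i))"
  proof
    fix i and s :: "nat \<Rightarrow> nat" assume s: "strict_mono s"
    \<comment> \<open>\<open>u n\<close> is controlled only up to time n, so finitely many terms may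
      be arbitrary. Truncating the values puts all terms in a compact interval and changes only
      those.\<close>
    define v where "v n = max (- (2/\<epsilon>)) (min (2/\<epsilon>) (u (s n) (Q i) (J i)))" for n
    have "v n \<in> {- (2/\<epsilon>) .. 2/\<epsilon>}" for n using R3 by (auto simp: v_def)
    then obtain l r where r: "strict_mono r" "(v \<circ> r) \<longlonglongrightarrow> l"
      using compact_imp_seq_compact[OF compact_Icc, of "- (2/\<epsilon>)" "2/\<epsilon>"] unfolding seq_compact_def by metis
    have "\<forall>\<^sub>F n in sequentially. (v \<circ> r) n = u ((s \<circ> r) n) (Q i) (J i)"
    proof -
      obtain N :: nat where N: "Q i \<le> real N" using real_arch_simple by blast
      have "(v \<circ> r) n = u ((s \<circ> r) n) (Q i) (J i)" if "N \<le> n" for n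
      proof -
        have "n \<le> (s \<circ> r) n" using s r(1) by (intro seq_suble strict_mono_o)
        then have "Q i \<in> {0..real ((s \<circ> r) n)}" using N that by (auto simp: Q_def)
        then have "\<bar>u ((s \<circ> r) n) (Q i) (J i)\<bar> \<le> 2/\<epsilon>" using tr unfolding trajectory_def by blast
        then show ?thesis by (auto simp: v_def)
      qed
      then show ?thesis by (auto simp: eventually_sequentially)
    qed
    with r(2) have "(\<lambda>n. u ((s \<circ> r) n) (Q i) (J i)) \<longlonglongrightarrow> l" by (rule Lim_transform_eventually)
    then show "\<exists>r'. strict_mono r' \<and> convergent (\<lambda>n. u ((s \<circ> r') n) (Q i) (J i))"
      using r(1) convergent_def by blast
  qed
  have Qconv: "convergent (\<lambda>n. u (diagseq n) (Q i) (J i))" for i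
  proof -
    have "convergent (\<lambda>n. u ((diagseq \<circ> ((+) (Suc i))) n) (Q i) (J i))"
    proof (rule diagseq_holds)
      fix i and r s :: "nat \<Rightarrow> nat"
      assume "strict_mono r" "convergent (\<lambda>n. u (s n) (Q i) (J i))"
      then show "convergent (\<lambda>n. u ((s \<circ> r) n) (Q i) (J i))"
        using convergent_subseq_convergent[of "\<lambda>n. u (s n) (Q i) (J i)" r] by (simp add: o_def)
    qed
    then show ?thesis
      using convergent_ignore_initial_segment[of "\<lambda>n. u (diagseq n) (Q i) (J i)" "Suc i"]
      by (simp add: add.commute)
  qed
  have Qc: "Cauchy (\<lambda>n. u (diagseq n) (real_of_rat q) j)" if "0 \<le> q" for q j
    using Qconv[of "to_nat (j, q)"] that by (simp add: Q_def J_def Cauchy_convergent_iff)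
  show ?thesis
  proof (rule that[OF subseq_diagseq])
    fix j and t :: real assume t: "0 \<le> t"
    have M0: "0 \<le> Mbd j" using rhs_bound[of "\<lambda>_. 0" j] R3 by fastforce
    have "Cauchy (\<lambda>n. u (diagseq n) t j)"
    proof (rule metric_CauchyI)
      fix e :: real assume e: "0 < e"
      define d where "d = e / (3 * (Mbd j + 1))"
      have "0 < d" using e M0 by (simp add: d_def)
      then obtain q where q: "t < real_of_rat q" "real_of_rat q < t + d"
        using of_rat_dense[of t "t + d"] by auto
      have q0: "0 \<le> real_of_rat q" using q t by linarith
      then have "0 \<le> q" by simp
      from metric_CauchyD[OF Qc[OF this], of "e/3" j] e
      obtain N1 where N1: "\<And>m n. N1 \<le> m \<Longrightarrow> N1 \<le> n \<Longrightarrow>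
          dist (u (diagseq m) (real_of_rat q) j) (u (diagseq n) (real_of_rat q) j) < e/3" by auto
      obtain N2 :: nat where N2: "real_of_rat q \<le> real N2" using real_arch_simple by blast
      have cl: "\<bar>u (diagseq n) t j - u (diagseq n) (real_of_rat q) j\<bar> < e/3" if "N2 \<le> n" for n
      proof -
        have "n \<le> diagseq n" by (intro seq_suble subseq_diagseq)
        then have "real_of_rat q \<le> real (diagseq n)" using N2 that by linarith
        then have "\<bar>u (diagseq n) t j - u (diagseq n) (real_of_rat q) j\<bar> \<le> Mbd j * \<bar>t - real_of_rat q\<bar>"
          using t q q0 unfolding atLeastAtMost_iff by (intro trajectory_lipschitz[OF tr]) (auto simp del: zero_le_of_rat_iff)
        also have "\<dots> \<le> Mbd j * d" using q M0 by (intro mult_left_mono) auto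
        also have "\<dots> < (Mbd j + 1) * d" using \<open>0 < d\<close> by (intro mult_strict_right_mono) auto
        also have "\<dots> = e/3"
        proof -
          have "Mbd j + 1 \<noteq> 0" using M0 by linarith
          then show ?thesis unfolding d_def by (simp add: divide_simps)
        qed
        finally show ?thesis .
      qed
      show "\<exists>N. \<forall>m\<ge>N. \<forall>n\<ge>N. dist (u (diagseq m) t j) (u (diagseq n) t j) < e"
      proof (intro exI[of _ "max N1 N2"] allI impI)
        fix m n assume "max N1 N2 \<le> m" "max N1 N2 \<le> n"
        then have "N1 \<le> m" "N1 \<le> n" "N2 \<le> m" "N2 \<le> n" by auto
        from N1[OF this(1,2)] cl[OF this(3)] cl[OF this(4)]
        show "dist (u (diagseq m) t j) (u (diagseq n) t j) < e"
          unfolding dist_real_def by linarith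
      qed
    qed
    then show "convergent (\<lambda>n. u (diagseq n) t j)" by (simp add: Cauchy_convergent_iff)
  qed
qed

definition global_trajectory :: "(nat \<Rightarrow> bool) \<Rightarrow> (real \<Rightarrow> nat \<Rightarrow> real) \<Rightarrow> bool" where
  "global_trajectory P u \<longleftrightarrow> (\<forall>t\<ge>0. \<forall>j. \<bar>u t j\<bar> \<le> 2/\<epsilon> \<and>
     ((\<lambda>s. u s j) has_real_derivative rhs (u t) j) (at t within {0..}) \<and>
     (P j \<longrightarrow> 0 \<le> u t j \<and> u t j \<le> env L (\<nu>^(j+1) * t)))"

lemma rhs_tendsto:
  assumes "\<And>i. (\<lambda>n. X n i) \<longlonglongrightarrow> Y i"
  shows "(\<lambda>n. rhs (X n) j) \<longlonglongrightarrow> rhs Y j"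
  unfolding rhs_def by (cases j) (auto intro!: tendsto_intros assms)

lemma rhs_cont:
  assumes "\<And>i. continuous_on S (\<lambda>t. X t i)"
  shows "continuous_on S (\<lambda>t. rhs (X t) j)"
  unfolding rhs_def by (cases j) (auto intro!: continuous_intros assms)

text \<open>The equation passes to the limit in integrated form, by dominated convergence. Each
  component involves only three modes, so pointwise convergence suffices; continuity of the limit
  then gives back the derivative.\<close>

lemma limit_trajectory:
  fixes u :: "nat \<Rightarrow> real \<Rightarrow> nat \<Rightarrow> real"
  assumes tr: "\<And>n. trajectory (real n) P (u n)" and r: "strict_mono r"
    and lim: "\<And>t j. 0 \<le> t \<Longrightarrow> (\<lambda>n. u (r n) t j) \<longlonglongrightarrow> U t j"
  shows "global_trajectory P U"
proof -
  have rn: "n \<le> r n" for n using r by (rule seq_suble)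
  have trI: "\<exists>N. \<forall>n\<ge>N. T \<le> real (r n)" for T
  proof -
    obtain N :: nat where "T \<le> real N" using real_arch_simple by blast
    then show ?thesis using rn by (intro exI[of _ N]) (meson le_trans of_nat_le_iff order_trans)
  qed
  have b: "\<bar>U t j\<bar> \<le> 2/\<epsilon>" if t: "0 \<le> t" for t j
  proof (rule LIMSEQ_le_const2[OF tendsto_rabs[OF lim[OF t]]])
    show "\<exists>N. \<forall>n\<ge>N. \<bar>u (r n) t j\<bar> \<le> 2/\<epsilon>"
      using trI[of t] tr t unfolding trajectory_def by (meson atLeastAtMost_iff)
  qed
  have P1: "0 \<le> U t j" if t: "0 \<le> t" and "P j" for t j
  proof (rule LIMSEQ_le_const[OF lim[OF t]])
    show "\<exists>N. \<forall>n\<ge>N. 0 \<le> u (r n) t j"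
      using trI[of t] tr that unfolding trajectory_def by (meson atLeastAtMost_iff)
  qed
  have P2: "U t j \<le> env L (\<nu>^(j+1) * t)" if t: "0 \<le> t" and "P j" for t j
  proof (rule LIMSEQ_le_const2[OF lim[OF t]])
    show "\<exists>N. \<forall>n\<ge>N. u (r n) t j \<le> env L (\<nu>^(j+1) * t)"
      using trI[of t] tr that unfolding trajectory_def by (meson atLeastAtMost_iff)
  qed
  have lip: "\<bar>U s j - U t j\<bar> \<le> Mbd j * \<bar>s - t\<bar>" if st: "0 \<le> s" "0 \<le> t" for s t j
  proof (rule LIMSEQ_le_const2[OF tendsto_rabs[OF tendsto_diff[OF lim[OF st(1)] lim[OF st(2)]]]])
    obtain N where "\<forall>n\<ge>N. max s t \<le> real (r n)" using trI by blast
    then show "\<exists>N. \<forall>n\<ge>N. \<bar>u (r n) s j - u (r n) t j\<bar> \<le> Mbd j * \<bar>s - t\<bar>"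
      using st by (intro exI[of _ N] allI impI trajectory_lipschitz[OF tr]) auto
  qed
  have M0: "0 \<le> Mbd j" for j using rhs_bound[of "\<lambda>_. 0" j] R3 by fastforce
  have cU: "continuous_on {0..} (\<lambda>t. U t j)" for j
  proof -
    have "(Mbd j)-lipschitz_on {0..} (\<lambda>t. U t j)"
      by (rule lipschitz_onI) (use lip M0 in \<open>auto simp: dist_real_def\<close>)
    then show ?thesis by (rule lipschitz_on_continuous_on)
  qed
  have cG: "continuous_on {0..} (\<lambda>t. rhs (U t) j)" for j by (rule rhs_cont[OF cU])
  have int: "U t j = U 0 j + integral {0..t} (\<lambda>s. rhs (U s) j)" if t: "0 \<le> t" for t j
  proof -
    obtain N where N: "\<And>n. n \<ge> N \<Longrightarrow> t \<le> real (r n)" using trI by blast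
    \<comment> \<open>Drops the terms whose time interval does not yet contain
      \<open>t\<close>.\<close>
    define w where "w n = u (r (n + N))" for n
    have wtr: "trajectory (real (r (n + N))) P (w n)" for n unfolding w_def by (rule tr)
    have wd: "((\<lambda>s. w n s i) has_real_derivative rhs (w n s) i) (at s within {0..t})" if "s \<in> {0..t}" for n s i
    proof -
      have "((\<lambda>s. w n s i) has_real_derivative rhs (w n s) i) (at s within {0..real (r (n + N))})"
        using wtr[of n] that N[of "n + N"] unfolding trajectory_def by auto
      then show ?thesis by (rule has_field_derivative_subset) (use N[of "n + N"] in auto)
    qed
    have wb: "\<bar>w n s i\<bar> \<le> 2/\<epsilon>" if "s \<in> {0..t}" for n s i
      using wtr[of n] that N[of "n + N"] unfolding trajectory_def by auto
    have wi: "((\<lambda>s. rhs (w n s) j) has_integral (w n t j - w n 0 j)) {0..t}" for n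
      using wd by (intro fundamental_theorem_of_calculus t)
        (auto simp: has_real_derivative_iff_has_vector_derivative[symmetric])
    have wl: "(\<lambda>n. w n s i) \<longlonglongrightarrow> U s i" if "0 \<le> s" for s i
      unfolding w_def by (rule LIMSEQ_ignore_initial_segment[OF lim[OF that]])
    have "(\<lambda>n. integral {0..t} (\<lambda>s. rhs (w n s) j)) \<longlonglongrightarrow> integral {0..t} (\<lambda>s. rhs (U s) j)"
    proof (rule dominated_convergence(2)[where h = "\<lambda>_. Mbd j"])
      show "(\<lambda>s. rhs (w n s) j) integrable_on {0..t}" for n using wi[of n] by blast
      show "norm (rhs (w n s) j) \<le> Mbd j" if "s \<in> {0..t}" for n s
        using rhs_bound[of "w n s" j] wb[OF that] by simp
      show "(\<lambda>n. rhs (w n s) j) \<longlonglongrightarrow> rhs (U s) j" if "s \<in> {0..t}" for s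
        using that by (intro rhs_tendsto wl) auto
    qed auto
    moreover have "integral {0..t} (\<lambda>s. rhs (w n s) j) = w n t j - w n 0 j" for n
      using wi by (rule integral_unique)
    moreover have "(\<lambda>n. w n t j - w n 0 j) \<longlonglongrightarrow> U t j - U 0 j"
      using t by (intro tendsto_intros wl) auto
    ultimately have "integral {0..t} (\<lambda>s. rhs (U s) j) = U t j - U 0 j"
      using LIMSEQ_unique by force
    then show ?thesis by simp
  qed
  have der: "((\<lambda>s. U s j) has_real_derivative rhs (U t) j) (at t within {0..})" if t: "0 \<le> t" for t j
  proof -
    have "((\<lambda>s. U 0 j + integral {0..s} (\<lambda>s. rhs (U s) j)) has_real_derivative rhs (U t) j) (at t within {0..})"
      using DERIV_add[OF DERIV_const[of "U 0 j"] integral_has_real_derivative_Ici[OF cG t]] by simp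
    then show ?thesis
      by (rule has_field_derivative_transform_within[where d = 1, OF _ _ _ int[symmetric]]) (use t in auto)
  qed
  show ?thesis unfolding global_trajectory_def using b der P1 P2 by blast
qed

text \<open>The first 2 n initial values agree for the n-th pair, so in the limit all do. The limits
  differ because at time 1/4 mode 0 is still large where it is active and already killed in the
  other solution.\<close>

lemma nonunique_trajectories:
  "\<exists>a b p. p \<in> data_box \<and> global_trajectory odd a \<and> global_trajectory even b \<and>
     (\<forall>j. a 0 j = p j \<and> b 0 j = p j) \<and> a (1/4) 0 \<noteq> b (1/4) 0"
proof -
  define \<Phi> where "\<Phi> n a b p \<longleftrightarrow> p \<in> data_box \<and> trajectory (real (Suc n)) odd a \<and>
    trajectory (real (Suc n)) even b \<and> (\<forall>j<2 * Suc n. a 0 j = p j \<and> b 0 j = p j) \<and> 7/10 \<le> a (1/4) 0"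
    for n a b p
  have "\<exists>a b p. \<Phi> n a b p" for n
    unfolding \<Phi>_def by (rule two_trajectories) auto
  then obtain a b p where "\<And>n. \<Phi> n (a n) (b n) (p n)" by metis
  then have *: "\<And>n. p n \<in> data_box" "\<And>n. trajectory (real (Suc n)) odd (a n)"
    "\<And>n. trajectory (real (Suc n)) even (b n)"
    "\<And>n j. j < 2 * Suc n \<Longrightarrow> a n 0 j = p n j \<and> b n 0 j = p n j" "\<And>n. 7/10 \<le> a n (1/4) 0"
    unfolding \<Phi>_def by blast+
  have mono: "trajectory T P u" if "trajectory T' P u" "T \<le> T'" for T T' P u
    using that unfolding trajectory_def
    by (auto intro: has_field_derivative_subset[where s = "{0..T'}"])
  have ta: "trajectory (real n) odd (a n)" for n by (rule mono[OF *(2)]) simp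
  have tb: "trajectory (real n) even (b n)" for n by (rule mono[OF *(3)]) simp
  obtain r where r: "strict_mono r" and ca: "\<And>j t. 0 \<le> t \<Longrightarrow> convergent (\<lambda>n. a (r n) t j)"
    using convergent_subsequence[OF ta] by metis
  have rn: "n \<le> r n" for n using r by (rule seq_suble)
  have tbr: "trajectory (real n) even (b (r n))" for n by (rule mono[OF tb]) (use rn in simp)
  obtain s where s: "strict_mono s" and cb: "\<And>j t. 0 \<le> t \<Longrightarrow> convergent (\<lambda>n. b (r (s n)) t j)"
    using convergent_subsequence[OF tbr] by metis
  define q where "q = r \<circ> s"
  have q: "strict_mono q" unfolding q_def using r s by (rule strict_mono_o)
  define A where "A t j = lim (\<lambda>n. a (q n) t j)" for t j
  define B where "B t j = lim (\<lambda>n. b (q n) t j)" for t j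
  have lA: "(\<lambda>n. a (q n) t j) \<longlonglongrightarrow> A t j" if "0 \<le> t" for t j
    using convergent_subseq_convergent[OF ca[OF that, of j] s]
    by (simp add: A_def q_def o_def convergent_LIMSEQ_iff)
  have lB: "(\<lambda>n. b (q n) t j) \<longlonglongrightarrow> B t j" if "0 \<le> t" for t j
    using cb[OF that, of j] by (simp add: B_def q_def o_def convergent_LIMSEQ_iff)
  have gA: "global_trajectory odd A" by (rule limit_trajectory[OF ta q lA])
  have gB: "global_trajectory even B" by (rule limit_trajectory[OF tb q lB])
  have ev: "\<forall>\<^sub>F n in sequentially. a (q n) 0 j = b (q n) 0 j \<and> 3/2 \<le> a (q n) 0 j \<and> a (q n) 0 j \<le> 5/2" for j
  proof (rule eventually_sequentiallyI[of j])
    fix n assume "j \<le> n"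
    also have "n \<le> q n" using q by (rule seq_suble)
    finally have "j < 2 * Suc (q n)" by simp
    from *(4)[OF this] *(1)[of "q n"]
    show "a (q n) 0 j = b (q n) 0 j \<and> 3/2 \<le> a (q n) 0 j \<and> a (q n) 0 j \<le> 5/2" by (auto simp: data_box_def)
  qed
  have eq: "B 0 j = A 0 j" for j
  proof (rule LIMSEQ_unique[OF lB])
    have "\<forall>\<^sub>F n in sequentially. a (q n) 0 j = b (q n) 0 j" using ev[of j] by eventually_elim auto
    with lA[of 0 j] show "(\<lambda>n. b (q n) 0 j) \<longlonglongrightarrow> A 0 j" by (auto intro: Lim_transform_eventually)
  qed simp
  have A0: "A 0 \<in> data_box" unfolding data_box_def
  proof (intro CollectI allI conjI)
    fix j
    show "3/2 \<le> A 0 j" by (rule tendsto_lowerbound[OF lA]) (use ev[of j] in \<open>auto elim: eventually_mono\<close>)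
    show "A 0 j \<le> 5/2" by (rule tendsto_upperbound[OF lA]) (use ev[of j] in \<open>auto elim: eventually_mono\<close>)
  qed
  have "7/10 \<le> A (1/4) 0" by (rule tendsto_lowerbound[OF lA]) (use *(5) in auto)
  moreover have "B (1/4) 0 \<le> 1/2"
  proof -
    have "B (1/4) 0 \<le> env L (\<nu>^(0+1) * (1/4))"
      using gB[unfolded global_trajectory_def, rule_format, of "1/4" 0] by simp
    \<comment> \<open>In the time of its killer mode 0 has reached nu / 4 \<ge> L + 9.\<close>
    also have "\<dots> \<le> env L (L + 9)" using nu by (intro env_antimono) simp
    also have "\<dots> = 3 * exp (- 9/4)" by (simp add: env_def)
    also have "\<dots> \<le> 1/2"
    proof -
      have "(5/2) ^ 2 \<le> exp (1::real) ^ 2"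
        by (intro power_mono) (use e_approx_32 in \<open>auto simp: abs_if split: if_splits\<close>)
      moreover have "exp (1::real) ^ 2 = exp 2" using exp_of_nat_mult[of 2 "1::real"] by simp
      moreover have "exp (2::real) \<le> exp (9/4)" by simp
      moreover have "(6::real) \<le> (5/2) ^ 2" by (simp add: power2_eq_square)
      ultimately have e: "6 \<le> exp (9/4::real)" by linarith
      have "exp (- 9/4::real) = inverse (exp (9/4))" by (simp flip: exp_minus)
      also have "\<dots> \<le> inverse 6" using e by (intro le_imp_inverse_le) auto
      finally show ?thesis by simp
    qed
    finally show ?thesis .
  qed
  ultimately have "A (1/4) 0 \<noteq> B (1/4) 0" by linarith
  with A0 gA gB eq show ?thesis by blast
qed

end

section \<open>Leray--Hopf solutions\<close>

locale dyadic = shell "lam\<^sup>2" "lam powr (2 - \<alpha>)" L for lam \<alpha> L :: real +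
  fixes N0 :: real
  assumes alpha: "2 < \<alpha>" and lam: "1 < lam" and N0: "0 < N0"
begin

abbreviation eps' where "eps' \<equiv> lam powr (2 - \<alpha>)"
abbreviation freq' where "freq' \<equiv> freq lam N0"

text \<open>Inverse of the normalization of u; it turns out to be geometric with ratio
  \<open>eps'\<close>, which fixes the regularity of the data.\<close>

definition scale :: "nat \<Rightarrow> real" where "scale k = (freq' (Suc k))\<^sup>2 / freq' k powr \<alpha>"

definition rescale :: "(real \<Rightarrow> nat \<Rightarrow> real) \<Rightarrow> real \<Rightarrow> nat \<Rightarrow> real" where
  "rescale X t k = scale k * X (N0\<^sup>2 * t) k"

lemma freq_pos: "0 < freq' k" using lam N0 by (simp add: freq_def)

lemma freq_sq: "(freq' k)\<^sup>2 = N0\<^sup>2 * (lam\<^sup>2)^k"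
  by (simp add: freq_def power_mult_distrib power_mult[symmetric] mult.commute)

lemma freq_Suc: "freq' (Suc k) = lam * freq' k" by (simp add: freq_def)

lemma scale_pos: "0 < scale k" using freq_pos[of k] freq_pos[of "Suc k"] by (simp add: scale_def)

lemma freq_scale: "freq' k powr \<alpha> * scale k = (freq' (Suc k))\<^sup>2"
  using freq_pos[of k] by (simp add: scale_def)

lemma scale_Suc: "scale (Suc k) = eps' * scale k"
proof -
  have "freq' (Suc k) powr \<alpha> = lam powr \<alpha> * freq' k powr \<alpha>"
    using lam freq_pos[of k] by (simp add: freq_Suc powr_mult)
  moreover have "lam powr (2 - \<alpha>) = lam\<^sup>2 / lam powr \<alpha>"
    using lam by (simp add: powr_diff)
  ultimately show ?thesis
    by (simp add: scale_def freq_Suc[of "Suc k"] power_mult_distrib)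
qed

lemma scale_eq: "scale k = scale 0 * eps' ^ k"
  by (induction k) (auto simp: scale_Suc)

text \<open>N_j^alpha times \<open>scale j\<close> is N_(j+1)^2, so the transfer coefficient into a
  mode equals its dissipation rate and both can be factored out.\<close>

lemma rhs_rescale:
  "obukhov_rhs \<alpha> lam N0 (\<lambda>k. scale k * Z k) k = scale k * (N0\<^sup>2 * rhs Z k)"
proof -
  have 1: "(case k of 0 \<Rightarrow> 0 | Suc j \<Rightarrow> freq' j powr \<alpha> * (scale j * Z j) * (scale k * Z k))
     = (freq' k)\<^sup>2 * (case k of 0 \<Rightarrow> 0 | Suc j \<Rightarrow> Z j) * (scale k * Z k)"
    using freq_scale by (cases k) (auto simp flip: mult.assoc)
  have "freq' k powr \<alpha> * (scale (Suc k) * Z (Suc k))\<^sup>2 = eps'\<^sup>2 * (freq' k powr \<alpha> * scale k) * scale k * (Z (Suc k))\<^sup>2"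
    by (simp add: scale_Suc power_mult_distrib power2_eq_square mult_ac)
  also have "\<dots> = eps'\<^sup>2 * (lam\<^sup>2 * (freq' k)\<^sup>2) * scale k * (Z (Suc k))\<^sup>2"
    by (simp add: freq_scale freq_Suc power_mult_distrib)
  finally have 2: "freq' k powr \<alpha> * (scale (Suc k) * Z (Suc k))\<^sup>2
     = eps'\<^sup>2 * (lam\<^sup>2 * (freq' k)\<^sup>2) * scale k * (Z (Suc k))\<^sup>2" .
  show ?thesis unfolding obukhov_rhs_def rhs_def 1 2 unfolding freq_sq by (simp add: algebra_simps)
qed

text \<open>Normalized data lie between positive constants, so the weighted squares are comparable
  to a geometric series of ratio lam^(2 (s + 2 - alpha)), below 1 exactly for s < alpha - 2.\<close>

lemma Hs_data_box:
  assumes p: "p \<in> data_box" and s: "s < \<alpha> - 2"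
  shows "(\<lambda>k. scale k * p k) \<in> Hs lam s"
proof -
  define q where "q = lam powr (2 * s) * eps'\<^sup>2"
  have "q = lam powr (2 * (s + 2 - \<alpha>))"
    unfolding q_def using lam by (simp add: power2_eq_square powr_add[symmetric] algebra_simps)
  also have "\<dots> < lam powr 0" using lam s by (intro powr_less_mono) auto
  finally have q: "0 \<le> q" "q < 1" using lam by (auto simp: q_def)
  have "summable (\<lambda>k. (scale 0)\<^sup>2 * (5/2)\<^sup>2 * q ^ k)"
    using q by (intro summable_mult summable_geometric) auto
  then have "summable (\<lambda>k. lam powr (2 * s * real k) * \<bar>scale k * p k\<bar>\<^sup>2)"
  proof (rule summable_comparison_test')
    fix k
    have "3/2 \<le> p k \<and> p k \<le> 5/2" using p by (auto simp: data_box_def)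
    then have "(p k)\<^sup>2 \<le> (5/2)\<^sup>2" by (intro power_mono) auto
    moreover have "lam powr (2 * s * real k) = (lam powr (2 * s)) ^ k"
      using lam by (simp add: powr_realpow[symmetric] powr_powr)
    then have "lam powr (2 * s * real k) * \<bar>scale k * p k\<bar>\<^sup>2 = ((scale 0)\<^sup>2 * q ^ k) * (p k)\<^sup>2"
      by (simp add: scale_eq[of k] q_def power_mult_distrib power_mult[symmetric] mult_ac)
    moreover have "0 \<le> (scale 0)\<^sup>2 * q ^ k" using q by simp
    ultimately have "lam powr (2 * s * real k) * \<bar>scale k * p k\<bar>\<^sup>2 \<le> ((scale 0)\<^sup>2 * q ^ k) * (5/2)\<^sup>2"
      by (simp only: mult_left_mono)
    then show "norm (lam powr (2 * s * real k) * \<bar>scale k * p k\<bar>\<^sup>2) \<le> (scale 0)\<^sup>2 * (5/2)\<^sup>2 * q ^ k"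
      by (simp add: mult_ac)
  qed
  then show ?thesis by (simp add: Hs_def)
qed

context
  fixes X P p
  assumes X: "global_trajectory P X" and P: "\<And>n. \<exists>m\<ge>n. P m" and p: "p \<in> data_box" "\<And>k. X 0 k = p k"
begin

abbreviation "u \<equiv> rescale X"
abbreviation "u0 \<equiv> (\<lambda>k. scale k * p k)"

lemma X_bound: "0 \<le> t \<Longrightarrow> \<bar>X t k\<bar> \<le> 2 / eps'"
  and X_der: "0 \<le> t \<Longrightarrow> ((\<lambda>s. X s k) has_real_derivative rhs (X t) k) (at t within {0..})"
  and X_dead: "0 \<le> t \<Longrightarrow> P k \<Longrightarrow> 0 \<le> X t k"
  using X unfolding global_trajectory_def by auto

lemma u_der:
  assumes t: "0 \<le> t"
  shows "((\<lambda>r. u r k) has_real_derivative obukhov_rhs \<alpha> lam N0 (u t) k) (at t within {0..})"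
proof -
  have im: "(\<lambda>s. N0\<^sup>2 * s) ` {0..} \<subseteq> {0..}" by auto
  have "((\<lambda>s. X s k) \<circ> (\<lambda>s. N0\<^sup>2 * s) has_real_derivative rhs (X (N0\<^sup>2 * t)) k * N0\<^sup>2) (at t within {0..})"
  proof (rule DERIV_image_chain)
    show "((\<lambda>s. X s k) has_real_derivative rhs (X (N0\<^sup>2 * t)) k) (at (N0\<^sup>2 * t) within (\<lambda>s. N0\<^sup>2 * s) ` {0..})"
      by (rule has_field_derivative_subset[OF X_der im]) (use t in simp)
    show "((\<lambda>s. N0\<^sup>2 * s) has_real_derivative N0\<^sup>2) (at t within {0..})"
      by (auto intro!: derivative_eq_intros)
  qed
  from DERIV_cmult[OF this, of "scale k"]
  have "((\<lambda>r. u r k) has_real_derivative scale k * (rhs (X (N0\<^sup>2 * t)) k * N0\<^sup>2)) (at t within {0..})"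
    by (simp add: rescale_def[abs_def] o_def)
  moreover have "u t = (\<lambda>k. scale k * X (N0\<^sup>2 * t) k)" by (simp add: rescale_def fun_eq_iff)
  ultimately show ?thesis by (simp add: rhs_rescale mult_ac)
qed

lemma u_cont: "continuous_on {0..} (\<lambda>t. u t k)"
  by (rule DERIV_continuous_on[OF u_der]) simp

lemma u_init: "u 0 k = u0 k" by (simp add: rescale_def p)

lemma u_solution: "S \<subseteq> {0..} \<Longrightarrow> obukhov_solution \<alpha> lam N0 S u0 u"
  unfolding obukhov_solution_def
  by (auto intro: continuous_on_subset[OF u_cont] has_field_derivative_subset[OF u_der] simp: u_init)

lemma u_sq_le: "0 \<le> t \<Longrightarrow> (u t k)\<^sup>2 \<le> (scale 0)\<^sup>2 * (2 / eps')\<^sup>2 * (eps'\<^sup>2)^k"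
proof -
  assume "0 \<le> t"
  then have "\<bar>X (N0\<^sup>2 * t) k\<bar> \<le> 2 / eps'" by (intro X_bound) simp
  then have "\<bar>X (N0\<^sup>2 * t) k\<bar>\<^sup>2 \<le> (2 / eps')\<^sup>2" by (intro power_mono) auto
  then have "(scale k)\<^sup>2 * (X (N0\<^sup>2 * t) k)\<^sup>2 \<le> (scale k)\<^sup>2 * (2 / eps')\<^sup>2" by (intro mult_left_mono) auto
  then show ?thesis
    by (simp add: rescale_def scale_eq[of k] power_mult_distrib power_mult[symmetric] mult_ac)
qed

lemma geometric_summable: "summable (\<lambda>k. (scale 0)\<^sup>2 * (2 / eps')\<^sup>2 * (eps'\<^sup>2)^k)"
proof -
  have "eps'\<^sup>2 < 1" using eps by (simp add: power_less_one_iff)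
  then show ?thesis by (intro summable_mult summable_geometric) auto
qed

lemma u_Linfty_L2: "u \<in> Linfty_L2 lam T"
proof -
  have "u t \<in> L2 lam \<and> Hs_norm lam 0 (u t) \<le> sqrt (\<Sum>k. (scale 0)\<^sup>2 * (2 / eps')\<^sup>2 * (eps'\<^sup>2)^k)"
    if t: "0 \<le> t" for t
  proof
    have s: "summable (\<lambda>k. (u t k)\<^sup>2)"
      by (rule summable_comparison_test'[OF geometric_summable]) (use u_sq_le[OF t] in simp)
    then show "u t \<in> L2 lam" using lam by (simp add: Hs_def)
    show "Hs_norm lam 0 (u t) \<le> sqrt (\<Sum>k. (scale 0)\<^sup>2 * (2 / eps')\<^sup>2 * (eps'\<^sup>2)^k)"
      unfolding Hs_norm_def using lam s u_sq_le[OF t]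
      by (auto intro!: suminf_le geometric_summable)
  qed
  then show ?thesis unfolding Linfty_L2_def
    by (intro CollectI exI[of _ "sqrt (\<Sum>k. (scale 0)\<^sup>2 * (2 / eps')\<^sup>2 * (eps'\<^sup>2)^k)"] AE_I2) auto
qed

section \<open>Energy balance\<close>

definition dissipation :: "nat \<Rightarrow> real \<Rightarrow> real" where
  "dissipation k t = integral {0..t} (\<lambda>s. (freq' k)\<^sup>2 * (u s k)\<^sup>2)"

text \<open>What mode k gains from mode k - 1 is what that mode loses, so the transfers telescope
  and only the flux out of mode m is left, with the sign of \<open>a m\<close>.\<close>

lemma energy_flux:
  "(\<Sum>k\<le>m. a k * obukhov_rhs \<alpha> lam N0 a k)
     = - (\<Sum>k\<le>m. (freq' k)\<^sup>2 * (a k)\<^sup>2) - freq' m powr \<alpha> * a m * (a (Suc m))\<^sup>2"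
  by (induction m) (simp_all add: obukhov_rhs_def algebra_simps power2_eq_square)

lemma cont_diss: "continuous_on {0..t} (\<lambda>s. (freq' k)\<^sup>2 * (u s k)\<^sup>2)"
  by (intro continuous_intros continuous_on_subset[OF u_cont]) auto

text \<open>The energy flux through a mode that stays nonnegative goes to higher modes.\<close>

lemma partial_energy:
  assumes t: "0 \<le> t" and m: "P m"
  shows "(\<Sum>k\<le>m. (u t k)\<^sup>2 / 2 + dissipation k t) \<le> (\<Sum>k\<le>m. (u0 k)\<^sup>2 / 2)"
proof -
  have der: "((\<lambda>s. \<Sum>k\<le>m. (u s k)\<^sup>2 / 2) has_vector_derivative (\<Sum>k\<le>m. u s k * obukhov_rhs \<alpha> lam N0 (u s) k)) (at s within {0..t})"
    if "s \<in> {0..t}" for s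
    unfolding has_real_derivative_iff_has_vector_derivative[symmetric]
    using that by (auto intro!: derivative_eq_intros sum.cong has_field_derivative_subset[OF u_der])
  have int: "((\<lambda>s. \<Sum>k\<le>m. u s k * obukhov_rhs \<alpha> lam N0 (u s) k) has_integral
      (\<Sum>k\<le>m. (u t k)\<^sup>2 / 2) - (\<Sum>k\<le>m. (u 0 k)\<^sup>2 / 2)) {0..t}"
    by (rule fundamental_theorem_of_calculus[OF t der])
  have int2: "((\<lambda>s. - (\<Sum>k\<le>m. (freq' k)\<^sup>2 * (u s k)\<^sup>2)) has_integral - (\<Sum>k\<le>m. dissipation k t)) {0..t}"
    unfolding dissipation_def
    by (intro has_integral_neg has_integral_sum finite_atMost integrable_integral integrable_continuous_interval cont_diss)
  have "(\<Sum>k\<le>m. (u t k)\<^sup>2 / 2) - (\<Sum>k\<le>m. (u 0 k)\<^sup>2 / 2) \<le> - (\<Sum>k\<le>m. dissipation k t)"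
  proof (rule has_integral_le[OF int int2])
    fix s assume "s \<in> {0..t}"
    then have "0 \<le> u s m" using X_dead[of "N0\<^sup>2 * s" m] m scale_pos[of m] by (simp add: rescale_def)
    then have "0 \<le> freq' m powr \<alpha> * u s m * (u s (Suc m))\<^sup>2" by simp
    then show "(\<Sum>k\<le>m. u s k * obukhov_rhs \<alpha> lam N0 (u s) k) \<le> - (\<Sum>k\<le>m. (freq' k)\<^sup>2 * (u s k)\<^sup>2)"
      unfolding energy_flux by simp
  qed
  then show ?thesis by (simp add: sum.distrib u_init)
qed

lemma diss_nonneg: "0 \<le> dissipation k t"
  unfolding dissipation_def by (intro integral_nonneg integrable_continuous_interval cont_diss) auto

lemma nn_dissipation:
  assumes t: "0 \<le> t"
  shows "(\<integral>\<^sup>+ s\<in>{0..t}. (\<Sum>k. ennreal ((freq' k)\<^sup>2 * (u s k)\<^sup>2)) \<partial>lborel) = (\<Sum>k. ennreal (dissipation k t))"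
proof -
  have e: "ennreal ((freq' k)\<^sup>2 * (u s k)\<^sup>2) * indicator {0..t} s = ennreal (indicat_real {0..t} s * ((freq' k)\<^sup>2 * (u s k)\<^sup>2))" for k s
    by (simp split: split_indicator)
  have "(\<integral>\<^sup>+ s\<in>{0..t}. (\<Sum>k. ennreal ((freq' k)\<^sup>2 * (u s k)\<^sup>2)) \<partial>lborel)
     = (\<integral>\<^sup>+ s. (\<Sum>k. ennreal (indicat_real {0..t} s * ((freq' k)\<^sup>2 * (u s k)\<^sup>2))) \<partial>lborel)"
    by (simp only: ennreal_suminf_multc[symmetric] e)
  also have "\<dots> = (\<Sum>k. \<integral>\<^sup>+ s. ennreal (indicat_real {0..t} s * ((freq' k)\<^sup>2 * (u s k)\<^sup>2)) \<partial>lborel)"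
  proof (rule nn_integral_suminf)
    fix k
    have "(\<lambda>s. indicat_real {0..t} s *\<^sub>R ((freq' k)\<^sup>2 * (u s k)\<^sup>2)) \<in> borel_measurable borel"
      by (rule borel_measurable_continuous_on_indicator[OF _ cont_diss]) simp
    then show "(\<lambda>s. ennreal (indicat_real {0..t} s * ((freq' k)\<^sup>2 * (u s k)\<^sup>2))) \<in> borel_measurable lborel"
      by simp
  qed
  also have "\<dots> = (\<Sum>k. ennreal (dissipation k t))"
    unfolding dissipation_def
    by (intro suminf_cong nn_integral_has_integral_lebesgue integrable_integral integrable_continuous_interval cont_diss) auto
  finally show ?thesis .
qed

text \<open>The truncated inequality is available only at cuts \<open>m\<close> with
  \<open>P m\<close>. These are cofinal, and all summands are nonnegative, so every partial sum lies
  below one that is controlled.\<close>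

lemma u_energy:
  assumes t: "0 \<le> t" shows "energy_inequality lam N0 u0 u t"
proof -
  have "(\<Sum>k. ennreal ((u t k)\<^sup>2 / 2)) + (\<Sum>k. ennreal (dissipation k t))
      = (\<Sum>k. ennreal ((u t k)\<^sup>2 / 2 + dissipation k t))"
    by (subst suminf_add) (auto simp: ennreal_plus diss_nonneg)
  also have "\<dots> \<le> (\<Sum>k. ennreal ((u0 k)\<^sup>2 / 2))"
  proof (rule suminf_le_const)
    fix n
    obtain m where m: "n \<le> m" "P m" using P by blast
    have "(\<Sum>k<n. ennreal ((u t k)\<^sup>2 / 2 + dissipation k t)) \<le> (\<Sum>k\<le>m. ennreal ((u t k)\<^sup>2 / 2 + dissipation k t))"
      using m by (intro sum_mono2) auto
    also have "\<dots> = ennreal (\<Sum>k\<le>m. (u t k)\<^sup>2 / 2 + dissipation k t)"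
      by (intro sum_ennreal) (simp add: diss_nonneg)
    also have "\<dots> \<le> ennreal (\<Sum>k\<le>m. (u0 k)\<^sup>2 / 2)"
      by (intro ennreal_leI partial_energy t m)
    also have "\<dots> = (\<Sum>k\<le>m. ennreal ((u0 k)\<^sup>2 / 2))" by (intro sum_ennreal[symmetric]) simp
    also have "\<dots> \<le> (\<Sum>k. ennreal ((u0 k)\<^sup>2 / 2))" by (rule sum_le_suminf) auto
    finally show "(\<Sum>k<n. ennreal ((u t k)\<^sup>2 / 2 + dissipation k t)) \<le> (\<Sum>k. ennreal ((u0 k)\<^sup>2 / 2))" .
  qed auto
  finally show ?thesis unfolding energy_inequality_def nn_dissipation[OF t] .
qed

lemma u0_L2: "u0 \<in> L2 lam" using Hs_data_box[OF p(1), of 0] alpha by simp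

text \<open>The energy inequality at time T makes \<open>F\<close> integrable, hence finite almost
  everywhere; where it is finite, the real-valued series in \<open>Hs_norm\<close> converges and
  equals \<open>F\<close> / N0^2.\<close>

lemma u_L2_H1:
  assumes T: "0 < T" shows "u \<in> L2_H1 lam T"
proof -
  define M where "M = lebesgue_on {0..T}"
  have S: "{0..T} \<in> sets lebesgue" by simp
  define F where "F s = (\<Sum>k. ennreal ((freq' k)\<^sup>2 * (u s k)\<^sup>2))" for s
  have meas: "(\<lambda>s. u s k) \<in> borel_measurable M" for k
    unfolding M_def by (rule continuous_imp_measurable_on_sets_lebesgue[OF continuous_on_subset[OF u_cont] S]) auto
  have Fm: "F \<in> borel_measurable M" unfolding F_def using meas by measurable
  have u0_fin: "(\<Sum>k. ennreal ((u0 k)\<^sup>2 / 2)) < \<infinity>"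
  proof -
    have "summable (\<lambda>k. (u0 k)\<^sup>2)" using u0_L2 lam by (simp add: Hs_def)
    then have "summable (\<lambda>k. (u0 k)\<^sup>2 / 2)" by (rule summable_divide)
    then show ?thesis by (subst suminf_ennreal2) auto
  qed
  have "integral\<^sup>N M F = (\<integral>\<^sup>+ s\<in>{0..T}. F s \<partial>lborel)"
    unfolding M_def by (subst nn_integral_restrict_space) (auto simp: nn_integral_completion)
  also have "\<dots> \<le> (\<Sum>k. ennreal ((u T k)\<^sup>2 / 2)) + (\<integral>\<^sup>+ s\<in>{0..T}. F s \<partial>lborel)"
    by (rule add_increasing) simp_all
  also have "\<dots> \<le> (\<Sum>k. ennreal ((u0 k)\<^sup>2 / 2))"
    using u_energy[OF less_imp_le[OF T]] unfolding energy_inequality_def F_def .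
  also note u0_fin
  finally have fin: "integral\<^sup>N M F < \<infinity>" .
  have AEfin: "AE s in M. F s \<noteq> \<infinity>" using Fm fin by (intro nn_integral_PInf_AE) auto
  have w: "lam powr (2 * 1 * real k) = (freq' k)\<^sup>2 / N0\<^sup>2" for k
  proof -
    have "lam powr (2 * 1 * real k) = lam powr real (2 * k)" by simp
    also have "\<dots> = lam ^ (2 * k)" using lam by (intro powr_realpow) simp
    finally show ?thesis using N0 by (simp add: freq_sq power_mult)
  qed
  have key: "u s \<in> Hs lam 1 \<and> ennreal ((Hs_norm lam 1 (u s))\<^sup>2) = ennreal (1 / N0\<^sup>2) * F s" if "F s \<noteq> \<infinity>" for s
  proof
    have sum: "summable (\<lambda>k. (freq' k)\<^sup>2 * (u s k)\<^sup>2)"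
      using that unfolding F_def by (intro summable_suminf_not_top) auto
    then have "summable (\<lambda>k. (freq' k)\<^sup>2 * (u s k)\<^sup>2 / N0\<^sup>2)" by (rule summable_divide)
    then show "u s \<in> Hs lam 1" unfolding Hs_def w by simp
    have "(Hs_norm lam 1 (u s))\<^sup>2 = (\<Sum>k. (freq' k)\<^sup>2 * (u s k)\<^sup>2 / N0\<^sup>2)"
      unfolding Hs_norm_def w using \<open>summable (\<lambda>k. (freq' k)\<^sup>2 * (u s k)\<^sup>2 / N0\<^sup>2)\<close>
      by (simp add: suminf_nonneg)
    also have "\<dots> = 1 / N0\<^sup>2 * (\<Sum>k. (freq' k)\<^sup>2 * (u s k)\<^sup>2)"
      using suminf_divide[OF sum] by simp
    finally have norm: "(Hs_norm lam 1 (u s))\<^sup>2 = 1 / N0\<^sup>2 * (\<Sum>k. (freq' k)\<^sup>2 * (u s k)\<^sup>2)" .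
    have "F s = ennreal (\<Sum>k. (freq' k)\<^sup>2 * (u s k)\<^sup>2)"
      unfolding F_def by (intro suminf_ennreal2 sum) auto
    then show "ennreal ((Hs_norm lam 1 (u s))\<^sup>2) = ennreal (1 / N0\<^sup>2) * F s"
      unfolding norm by (simp only:) (rule ennreal_mult, auto intro: suminf_nonneg sum)
  qed
  have "AE s in M. u s \<in> Hs lam 1" using AEfin key by (auto elim: eventually_mono)
  moreover have "integrable M (\<lambda>s. (Hs_norm lam 1 (u s))\<^sup>2)"
  proof (rule integrableI_nonneg)
    show "(\<lambda>s. (Hs_norm lam 1 (u s))\<^sup>2) \<in> borel_measurable M"
      unfolding Hs_norm_def using meas by measurable
    have "(\<integral>\<^sup>+ s. ennreal ((Hs_norm lam 1 (u s))\<^sup>2) \<partial>M) = (\<integral>\<^sup>+ s. ennreal (1 / N0\<^sup>2) * F s \<partial>M)"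
      using AEfin key by (intro nn_integral_cong_AE) (auto elim: eventually_mono)
    also have "\<dots> = ennreal (1 / N0\<^sup>2) * integral\<^sup>N M F" by (rule nn_integral_cmult[OF Fm])
    also have "\<dots> < \<infinity>" using fin by (simp add: ennreal_mult_less_top)
    finally show "(\<integral>\<^sup>+ s. ennreal ((Hs_norm lam 1 (u s))\<^sup>2) \<partial>M) < \<infinity>" .
  qed auto
  ultimately show ?thesis unfolding L2_H1_def M_def by simp
qed

lemma rescale_leray_hopf: "leray_hopf \<alpha> lam N0 u0 u"
  unfolding leray_hopf_def leray_hopf_on_def
  using u_solution[of "{0..}"] u_solution[of "{0..T}" for T] u0_L2 u_Linfty_L2 u_L2_H1 u_energy by auto

end

lemma nonuniqueness:
  "\<exists>u0 \<in> (\<Inter>s\<in>{..<\<alpha> - 2}. Hs lam s). \<exists>u v.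
     leray_hopf \<alpha> lam N0 u0 u \<and> leray_hopf \<alpha> lam N0 u0 v \<and> (\<exists>t\<ge>0. u t \<noteq> v t)"
proof -
  obtain a b p where ab: "p \<in> data_box" "global_trajectory odd a" "global_trajectory even b"
    "\<And>j. a 0 j = p j" "\<And>j. b 0 j = p j" "a (1/4) 0 \<noteq> b (1/4) 0"
    using nonunique_trajectories by blast
  have "\<exists>m\<ge>n. odd m" "\<exists>m\<ge>n. even m" for n :: nat
    by (intro exI[of _ "2 * n + 1"]; simp) (intro exI[of _ "2 * n"]; simp)
  then have lh: "leray_hopf \<alpha> lam N0 (\<lambda>k. scale k * p k) (rescale a)"
    "leray_hopf \<alpha> lam N0 (\<lambda>k. scale k * p k) (rescale b)"
    using ab by (auto intro: rescale_leray_hopf)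
  have "rescale a (1/4 / N0\<^sup>2) 0 \<noteq> rescale b (1/4 / N0\<^sup>2) 0"
    using ab(6) scale_pos[of 0] N0 by (simp add: rescale_def)
  then have ne: "rescale a (1/4 / N0\<^sup>2) \<noteq> rescale b (1/4 / N0\<^sup>2)" by metis
  show ?thesis
  proof (intro bexI[of _ "\<lambda>k. scale k * p k"] exI conjI)
    show "rescale a (1/4 / N0\<^sup>2) \<noteq> rescale b (1/4 / N0\<^sup>2)" by (rule ne)
  qed (use lh Hs_data_box[OF ab(1)] N0 in auto)
qed

end

text \<open>\<open>L\<close> is its smallest admissible value, so exp (L / 2) = e^150 eps^(-5/4).
  The drain condition divided by eps thus contains eps^(2 - 5/4), the exponent 3/4 below.\<close>

lemma eventually_shell:
  fixes \<alpha> :: real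
  assumes "2 < \<alpha>" "\<alpha> < 4"
  shows "\<forall>\<^sub>F lam in at_top. shell (lam\<^sup>2) (lam powr (2 - \<alpha>)) (5/2 * ((\<alpha> - 2) * ln lam) + 300)"
proof -
  have 1: "\<forall>\<^sub>F x::real in at_top. x powr (2 - \<alpha>) \<le> 1/100"
    using assms by real_asymp
  \<comment> \<open>The forcing condition, of order lam^(alpha - 4) ln lam; here alpha < 4
    enters.\<close>
  have 2: "\<forall>\<^sub>F x::real in at_top. (1 + 2 * x powr (\<alpha> - 2)) / x\<^sup>2 * (5/2 * ((\<alpha> - 2) * ln x) + 300) \<le> 1/1000"
    using assms by real_asymp
  have 3: "\<forall>\<^sub>F x::real in at_top. 4 * (5/2 * ((\<alpha> - 2) * ln x) + 300 + 9) \<le> x\<^sup>2"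
    using assms by real_asymp
  have 4: "\<forall>\<^sub>F x::real in at_top. 180 * x powr ((2 - \<alpha>) * (3/4)) * exp 150 / x\<^sup>2 \<le> 1"
    using assms by real_asymp
  show ?thesis using 1 2 3 4 eventually_gt_at_top[of 1]
  proof eventually_elim
    case (elim x)
    define e where "e = x powr (2 - \<alpha>)"
    have e: "0 < e" "1 / e = x powr (\<alpha> - 2)" using elim by (auto simp: e_def powr_diff)
    have ln: "ln (1 / e) = (\<alpha> - 2) * ln x" unfolding e(2) using elim by (simp add: ln_powr)
    have "exp ((5/2 * ((\<alpha> - 2) * ln x) + 300) / 2) = exp 150 * x powr ((\<alpha> - 2) * (5/4))"
    proof -
      have eq: "(5/2 * ((\<alpha> - 2) * ln x) + 300) / 2 = 150 + (\<alpha> - 2) * (5/4) * ln x" by (simp add: field_simps)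
      show ?thesis unfolding eq using elim by (simp add: powr_def exp_add)
    qed
    moreover have "e^3 = e * x powr (2 * (2 - \<alpha>))"
      using elim by (simp add: e_def power3_eq_cube powr_add[symmetric] algebra_simps)
    ultimately have "18 * e^3 * exp ((5/2 * ((\<alpha> - 2) * ln x) + 300) / 2) / x\<^sup>2
      = 18 * e * (x powr (2 * (2 - \<alpha>)) * x powr ((\<alpha> - 2) * (5/4))) * exp 150 / x\<^sup>2" by simp
    also have "x powr (2 * (2 - \<alpha>)) * x powr ((\<alpha> - 2) * (5/4)) = x powr ((2 - \<alpha>) * (3/4))"
      unfolding powr_add[symmetric] by (rule arg_cong[of _ _ "(powr) x"]) (simp add: field_simps)
    also have "18 * e * x powr ((2 - \<alpha>) * (3/4)) * exp 150 / x\<^sup>2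
       = e / 10 * (180 * x powr ((2 - \<alpha>) * (3/4)) * exp 150 / x\<^sup>2)" by simp
    also have "\<dots> \<le> e / 10 * 1" using elim(4) e(1) by (intro mult_left_mono) auto
    finally have D: "18 * e^3 * exp ((5/2 * ((\<alpha> - 2) * ln x) + 300) / 2) / x\<^sup>2 \<le> e / 10" by simp
    show ?case unfolding e_def[symmetric]
    proof
      show "(1 + 2 / e) / x\<^sup>2 * (5/2 * ((\<alpha> - 2) * ln x) + 300) \<le> 1/1000"
        using elim(2) unfolding e(2)[symmetric] by simp
    qed (use elim e ln D in \<open>auto simp: e_def[symmetric]\<close>)
  qed
qed

theorem theorem1p2:
  fixes \<alpha> :: real
  assumes "2 < \<alpha>" and "\<alpha> < 4"
  shows "\<exists>lam0>1. \<forall>lam\<ge>lam0. \<forall>N0>0.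
           \<exists>u0 \<in> (\<Inter>s\<in>{..<\<alpha> - 2}. Hs lam s). \<exists>u v.
             leray_hopf \<alpha> lam N0 u0 u \<and> leray_hopf \<alpha> lam N0 u0 v \<and> (\<exists>t\<ge>0. u t \<noteq> v t)"
proof -
  obtain l where l: "\<And>lam. l \<le> lam \<Longrightarrow> shell (lam\<^sup>2) (lam powr (2 - \<alpha>)) (5/2 * ((\<alpha> - 2) * ln lam) + 300)"
    using eventually_shell[OF assms] unfolding eventually_at_top_linorder by blast
  show ?thesis
  \<comment> \<open>The 2 secures \<open>lam0 > 1\<close>. The threshold \<open>l\<close> comes from
    conditions free of \<open>N0\<close>, since time is measured in units of N0^(-2).\<close>
  proof (intro exI[of _ "max l 2"] conjI allI impI)
    fix lam N0 :: real assume "max l 2 \<le> lam" "0 < N0"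
    then interpret dyadic lam \<alpha> "5/2 * ((\<alpha> - 2) * ln lam) + 300" N0
      using l[of lam] assms by (auto simp: dyadic_def dyadic_axioms_def)
    show "\<exists>u0 \<in> (\<Inter>s\<in>{..<\<alpha> - 2}. Hs lam s). \<exists>u v.
             leray_hopf \<alpha> lam N0 u0 u \<and> leray_hopf \<alpha> lam N0 u0 v \<and> (\<exists>t\<ge>0. u t \<noteq> v t)"
      by (rule nonuniqueness)
  qed simp
qed

end
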